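(* Let $t$ be a positive integer. The existence of the following are equivalent: (i) a skew-symmetric Seidel matrix with characteristic polynomial $(x^2+4t+3)^{2t+2}$; (ii) a skew-symmetric Seidel matrix with characteristic polynomial $x(x^2+4t+3)^{2t+1}$; (iii) a skew-symmetric Seidel matrix with characteristic polynomial $(x^2+1)(x^2+4t+3)^{2t}$; (iv) a skew-symmetric Seidel matrix with characteristic polynomial $x(x^2+3)(x^2+4t+3)^{2t-1}$.
   Context: A Seidel matrix is a square $\{0,\pm1\}$-matrix $S$ with zero diagonal, all off-diagonal entries nonzero, and $S=\pm S^\top$; it is skew-symmetric if $S^\top=-S$. The characteristic polynomial of $S$ is $\det(xI-S)$. *)

theory Defs
  imports "Jordan_Normal_Form.Char_Poly"
begin

definition seidel_mat :: "int mat \<Rightarrow> bool" where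
  "seidel_mat S \<longleftrightarrow>
     square_mat S \<and>
     elements_mat S \<subseteq> {-1, 0, 1} \<and>
     (\<forall>i < dim_row S. S $$ (i, i) = 0) \<and>
     (\<forall>i < dim_row S. \<forall>j < dim_row S. i \<noteq> j \<longrightarrow> S $$ (i, j) \<noteq> 0) \<and>
     (S = transpose_mat S \<or> S = - transpose_mat S)"

definition skew_seidel_mat :: "int mat \<Rightarrow> bool" where
  "skew_seidel_mat S \<longleftrightarrow> seidel_mat S \<and> transpose_mat S = - S"

end

theory Submission
  imports Defs "Jordan_Normal_Form.Schur_Decomposition"
begin

text \<open>Put \<open>c = 4t + 3\<close>. Condition (i) says that \<open>S\<^sup>2 = -c I\<close>. Deleting 1, 2 or 3 rows and the same columns
  from such an \<open>S\<close> gives (ii), (iii) and (iv), because the characteristic polynomials of complementary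
  principal submatrices \<open>T\<close> and \<open>S\<^sub>0\<close> satisfy \<open>\<chi>\<^sub>S \<chi>\<^sub>T = (x\<^sup>2 + c)\<^sup>k \<chi>\<close>, \<open>\<chi>\<close> being that of \<open>S\<^sub>0\<close>.
  Conversely, let \<open>S\<close> be as in (ii), (iii) or (iv), of order \<open>4t + 4 - k\<close>. The spectrum shows that the
  integral positive semidefinite matrix \<open>B = c I + S\<^sup>2\<close> has rank \<open>k\<close>, and a combinatorial analysis of its
  small entries writes it as \<open>B = A A\<^sup>T\<close> with a \<open>\<plusminus>1\<close> matrix \<open>A\<close> with \<open>k\<close> columns. Bordering \<open>S\<close> by \<open>A\<close> and
  a suitable skew Seidel matrix of order \<open>k\<close> gives a matrix as in (i).\<close>

section \<open>Triangularisation and traces\<close>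

text \<open>The sizes fit as follows. With \<open>c = 4t + 3\<close> and order
  \<open>n = 4t + 4 - k\<close>, the diagonal entries of \<open>B\<close> are
  \<open>c - (n - 1) = k\<close> and the other entries have the parity of \<open>k\<close>, as inner
  products of sign vectors of length \<open>k\<close> must. For \<open>k = 1\<close> and
  \<open>k = 2\<close> the only nonzero eigenvalue of \<open>B\<close> is \<open>n\<close>, so
  \<open>B\<close> is a multiple of a projection; for \<open>k = 3\<close> both \<open>c\<close> and
  \<open>c - 3\<close> occur, and two polynomials in \<open>B\<close> separate them.
  Semidefiniteness is used over the integers only: if \<open>g\<close> is symmetric with
  \<open>g^2 = \<kappa> g\<close>, the inner products of its rows are \<kappa> times its entries, so
  inequalities and their equality cases come from sums of integer squares. The recurring factor 2
  has a parity origin: the coordinates of an integral combination of sign vectors all have the same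
  parity, so for \<open>k \<ge> 2\<close> no integral dual system of the columns of \<open>A\<close>
  has value 1. Deletion is uniform for \<open>k \<le> 3\<close> because \<open>k\<close> alone
  determines the characteristic polynomial of the deleted block; in order 4 its determinant can be 1
  or 9.\<close>

text \<open>The change of basis \<open>(P, Q)\<close> is fixed once for \<open>S\<close>; the matrices it triangularises with diagonal
  \<open>f\<close> then include every polynomial \<open>p(S)\<close>, with \<open>f i = p(e i)\<close> for the eigenvalues \<open>e i\<close> of \<open>S\<close>.
  This avoids the spectral theorem and the Cayley-Hamilton theorem.\<close>

definition triangularised :: "complex mat \<Rightarrow> complex mat \<Rightarrow> nat \<Rightarrow> int mat \<Rightarrow> (nat \<Rightarrow> complex) \<Rightarrow> bool" where
  "triangularised P Q n M f \<longleftrightarrow> M \<in> carrier_mat n n \<and>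
     (\<forall>i<n. \<forall>j\<le>i. (Q * map_mat of_int M * P) $$ (i, j) = (if i = j then f i else 0))"

text \<open>Schur decomposition over the complex numbers. The numbers \<open>e i\<close> are
  recorded only as roots, without multiplicities; where a multiplicity matters it is recovered from
  a trace.\<close>

lemma char_poly_eigenvalues:
  fixes M :: "int mat"
  assumes M: "M \<in> carrier_mat n n"
  obtains P Q e where "P \<in> carrier_mat n n" "Q \<in> carrier_mat n n" "P * Q = 1\<^sub>m n" "Q * P = 1\<^sub>m n"
    "triangularised P Q n M e"
    "\<And>i. i < n \<Longrightarrow> poly (map_poly of_int (char_poly M)) (e i :: complex) = 0"
proof -
  let ?M = "map_mat complex_of_int M"
  have CM: "?M \<in> carrier_mat n n" using M by simp
  obtain es where es: "char_poly ?M = (\<Prod>a\<leftarrow>es. [:- a, 1:])" and len: "length es = n"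
    using char_poly_factorized[OF CM] by auto
  obtain U P Q where sd: "schur_decomposition ?M es = (U, P, Q)" by (cases "schur_decomposition ?M es") auto
  have wit: "similar_mat_wit ?M U P Q" and ut: "upper_triangular U" and dg: "diag_mat U = es"
    using schur_decomposition[OF CM es sd] by auto
  have c: "P \<in> carrier_mat n n" "Q \<in> carrier_mat n n" "U \<in> carrier_mat n n"
    and PQ: "P * Q = 1\<^sub>m n" and QP: "Q * P = 1\<^sub>m n" and MU: "?M = P * U * Q"
    using similar_mat_witD2[OF CM wit] by auto
  have "Q * ?M * P = Q * (P * U * Q) * P" using MU by simp
  also have "\<dots> = (Q * P) * U * (Q * P)"
    using c by (simp add: assoc_mult_mat[of _ n n _ n _ n])
  also have "\<dots> = U" using c QP by simp
  finally have U: "Q * ?M * P = U" .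
  have "triangularised P Q n M (\<lambda>i. es ! i)"
    unfolding triangularised_def U
    using M ut c(3) dg by (auto simp: diag_mat_def dest: upper_triangularD)
  moreover have "poly (map_poly of_int (char_poly M)) (es ! i) = 0" if i: "i < n" for i
  proof -
    have "map_poly of_int (char_poly M) = (\<Prod>a\<leftarrow>es. [:- a, 1:])"
      using of_int_hom.char_poly_hom[OF M] es by metis
    moreover have "es ! i \<in> set es" using i len by simp
    ultimately show ?thesis by (auto simp: poly_prod_list prod_list_zero_iff image_iff)
  qed
  ultimately show ?thesis using that c PQ QP by blast
qed

locale triangularising =
  fixes P Q :: "complex mat" and n :: nat
  assumes P: "P \<in> carrier_mat n n" and Q: "Q \<in> carrier_mat n n"
    and PQ: "P * Q = 1\<^sub>m n" and QP: "Q * P = 1\<^sub>m n"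
begin

lemma conjugate_mult:
  assumes "X \<in> carrier_mat n n" "Y \<in> carrier_mat n n"
  shows "Q * (X * Y) * P = (Q * X * P) * (Q * Y * P)"
proof -
  have "(Q * X * P) * (Q * Y * P) = Q * X * (P * Q) * (Y * P)"
    using assms P Q by (simp add: assoc_mult_mat[of _ n n _ n _ n])
  also have "\<dots> = Q * (X * Y) * P"
    unfolding PQ using assms P Q by (simp add: assoc_mult_mat[of _ n n _ n _ n])
  finally show ?thesis ..
qed

text \<open>Both conjugated factors vanish below the diagonal, so in entry \<open>(i, j)\<close>
  with \<open>j \<le> i\<close> only the summand \<open>k = i\<close> can survive.\<close>

lemma triangularised_mult:
  assumes X: "triangularised P Q n X f" and Y: "triangularised P Q n Y g"
  shows "triangularised P Q n (X * Y) (\<lambda>i. f i * g i)"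
  unfolding triangularised_def
proof (intro conjI allI impI)
  have c: "X \<in> carrier_mat n n" "Y \<in> carrier_mat n n" using X Y by (auto simp: triangularised_def)
  then show "X * Y \<in> carrier_mat n n" by simp
  fix i j assume i: "i < n" and j: "j \<le> i"
  let ?h = "map_mat complex_of_int"
  let ?x = "Q * ?h X * P" and ?y = "Q * ?h Y * P"
  have "(Q * ?h (X * Y) * P) $$ (i, j) = (?x * ?y) $$ (i, j)"
    using c conjugate_mult[of "?h X" "?h Y"] by (simp add: of_int_hom.mat_hom_mult[of _ n n _ n])
  also have "\<dots> = (\<Sum>k<n. ?x $$ (i, k) * ?y $$ (k, j))"
    using i j P Q c by (simp add: scalar_prod_def lessThan_atLeast0)
  also have "\<dots> = (\<Sum>k<n. if k = i then (if i = j then f i * g i else 0) else 0)"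
  proof (rule sum.cong[OF refl])
    fix k assume k: "k \<in> {..<n}"
    show "?x $$ (i, k) * ?y $$ (k, j) = (if k = i then (if i = j then f i * g i else 0) else 0)"
    proof (cases "k < i")
      case True
      then show ?thesis using X i by (auto simp: triangularised_def)
    next
      case False
      then show ?thesis using X Y i j k by (auto simp: triangularised_def)
    qed
  qed
  also have "\<dots> = (if i = j then f i * g i else 0)" using i by simp
  finally show "(Q * ?h (X * Y) * P) $$ (i, j) = (if i = j then f i * g i else 0)" .
qed

lemma conjugate_index:
  assumes "X \<in> carrier_mat n n" "i < n" "j < n"
  shows "(Q * X * P) $$ (i, j) = (\<Sum>k<n. \<Sum>l<n. Q $$ (i, k) * X $$ (k, l) * P $$ (l, j))"
proof -
  have "(Q * X * P) $$ (i, j) = (Q * (X * P)) $$ (i, j)"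
    using assms P Q by (simp add: assoc_mult_mat[of _ n n _ n _ n])
  also have "\<dots> = (\<Sum>k<n. \<Sum>l<n. Q $$ (i, k) * X $$ (k, l) * P $$ (l, j))"
    using assms P Q by (simp add: scalar_prod_def lessThan_atLeast0 sum_distrib_left mult_ac)
  finally show ?thesis .
qed

lemma triangularised_add:
  assumes X: "triangularised P Q n X f" and Y: "triangularised P Q n Y g"
  shows "triangularised P Q n (X + Y) (\<lambda>i. f i + g i)"
proof -
  have c: "X \<in> carrier_mat n n" "Y \<in> carrier_mat n n" using X Y by (auto simp: triangularised_def)
  show ?thesis
    using X Y c unfolding triangularised_def
    by (auto simp: conjugate_index sum.distrib algebra_simps)
qed

lemma triangularised_smult:
  assumes X: "triangularised P Q n X f"
  shows "triangularised P Q n (a \<cdot>\<^sub>m X) (\<lambda>i. of_int a * f i)"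
proof -
  have c: "X \<in> carrier_mat n n" using X by (auto simp: triangularised_def)
  have "(Q * map_mat complex_of_int (a \<cdot>\<^sub>m X) * P) $$ (i, j)
      = of_int a * (Q * map_mat complex_of_int X * P) $$ (i, j)" if "i < n" "j < n" for i j
    using that c by (simp add: conjugate_index sum_distrib_left mult_ac)
  then show ?thesis using X c unfolding triangularised_def by auto
qed

lemma triangularised_one: "triangularised P Q n (1\<^sub>m n) (\<lambda>i. 1)"
  using Q P by (simp add: triangularised_def of_int_hom.mat_hom_one QP)

lemma triangularised_trace:
  assumes X: "triangularised P Q n X f"
  shows "of_int (\<Sum>i<n. X $$ (i, i)) = (\<Sum>i<n. f i)"
proof -
  have c: "X \<in> carrier_mat n n" using X by (auto simp: triangularised_def)
  let ?X = "map_mat complex_of_int X"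
  have "(\<Sum>i<n. f i) = (\<Sum>i<n. (Q * ?X * P) $$ (i, i))" using X by (simp add: triangularised_def)
  also have "\<dots> = (\<Sum>i<n. \<Sum>k<n. \<Sum>l<n. Q $$ (i, k) * ?X $$ (k, l) * P $$ (l, i))"
    using c by (simp add: conjugate_index)
  also have "\<dots> = (\<Sum>k<n. \<Sum>i<n. \<Sum>l<n. Q $$ (i, k) * ?X $$ (k, l) * P $$ (l, i))"
    by (rule sum.swap)
  also have "\<dots> = (\<Sum>k<n. \<Sum>l<n. \<Sum>i<n. Q $$ (i, k) * ?X $$ (k, l) * P $$ (l, i))"
    by (intro sum.cong refl sum.swap)
  also have "\<dots> = (\<Sum>k<n. \<Sum>l<n. ?X $$ (k, l) * (P * Q) $$ (l, k))"
    using P Q c by (intro sum.cong refl) (simp add: scalar_prod_def lessThan_atLeast0 sum_distrib_left mult_ac)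
  also have "\<dots> = (\<Sum>k<n. ?X $$ (k, k))"
    unfolding PQ using c by (intro sum.cong refl) (simp add: if_distrib if_distribR cong: if_cong)
  finally show ?thesis using c by simp
qed

text \<open>The trace of \<open>X\<^sup>2\<close> is the sum of the squares of the entries of the symmetric matrix \<open>X\<close>.\<close>

lemma triangularised_symmetric_eq_0:
  assumes X: "triangularised P Q n X f" and sym: "\<And>i j. i < n \<Longrightarrow> j < n \<Longrightarrow> X $$ (i, j) = X $$ (j, i)"
    and f: "\<And>i. i < n \<Longrightarrow> f i = 0" and ij: "i < n" "j < n"
  shows "X $$ (i, j) = 0"
proof -
  have c: "X \<in> carrier_mat n n" using X by (auto simp: triangularised_def)
  have "complex_of_int (\<Sum>i<n. (X * X) $$ (i, i)) = 0"
    using triangularised_trace[OF triangularised_mult[OF X X]] f by simp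
  then have "0 = (\<Sum>i<n. (X * X) $$ (i, i))" by (metis of_int_eq_0_iff)
  also have "\<dots> = (\<Sum>i<n. \<Sum>j<n. (X $$ (i, j))\<^sup>2)"
    using c sym by (intro sum.cong refl) (simp add: scalar_prod_def lessThan_atLeast0 power2_eq_square)
  finally have "(\<Sum>i<n. \<Sum>j<n. (X $$ (i, j))\<^sup>2) = 0" by simp
  then show ?thesis using ij by (auto simp: sum_nonneg_eq_0_iff sum_nonneg)
qed

end

section \<open>Characteristic polynomials of principal submatrices\<close>

lemma transpose_mat_eq_uminusI:
  assumes S: "S \<in> carrier_mat n n" and skew: "\<And>i j. i < n \<Longrightarrow> j < n \<Longrightarrow> S $$ (j, i) = - S $$ (i, j)"
  shows "transpose_mat S = - S"
proof (rule eq_matI)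
  fix i j assume "i < dim_row (- S)" "j < dim_col (- S)"
  then have ij: "i < n" "j < n" using S by auto
  show "transpose_mat S $$ (i, j) = (- S) $$ (i, j)" using S ij skew[OF ij] by simp
qed (use S in auto)

text \<open>Over the integers skewness already forces a zero diagonal. The pointwise form reduces
  the property for submatrices and block matrices to index checks.\<close>

lemma skew_seidel_mat_iff:
  assumes S: "S \<in> carrier_mat n n"
  shows "skew_seidel_mat S \<longleftrightarrow>
    (\<forall>i<n. \<forall>j<n. S $$ (j, i) = - S $$ (i, j)) \<and> (\<forall>i<n. \<forall>j<n. i \<noteq> j \<longrightarrow> \<bar>S $$ (i, j)\<bar> = 1)"
    (is "_ \<longleftrightarrow> ?R")
proof
  assume s: "skew_seidel_mat S"
  have t: "transpose_mat S = - S" using s by (simp add: skew_seidel_mat_def)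
  have sk: "S $$ (j, i) = - S $$ (i, j)" if "i < n" "j < n" for i j
    using arg_cong[OF t, of "\<lambda>M. M $$ (i, j)"] that S by simp
  have "\<bar>S $$ (i, j)\<bar> = 1" if "i < n" "j < n" "i \<noteq> j" for i j
  proof -
    have "S $$ (i, j) \<in> elements_mat S" using S that by (intro elements_matI) auto
    then have "S $$ (i, j) \<in> {-1, 0, 1}" using s by (auto simp: skew_seidel_mat_def seidel_mat_def)
    moreover have "S $$ (i, j) \<noteq> 0" using s S that by (auto simp: skew_seidel_mat_def seidel_mat_def)
    ultimately show ?thesis by auto
  qed
  then show ?R using sk by blast
next
  assume R: ?R
  then have d: "S $$ (i, i) = 0" if "i < n" for i using that by (metis equal_neg_zero)
  have "elements_mat S \<subseteq> {-1, 0, 1}"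
  proof
    fix x assume "x \<in> elements_mat S"
    then obtain i j where ij: "i < n" "j < n" "x = S $$ (i, j)" using S by (auto dest!: elements_matD)
    show "x \<in> {-1, 0, 1}"
    proof (cases "i = j")
      case True then show ?thesis using d ij by simp
    next
      case False
      then have "\<bar>x\<bar> = 1" using R ij by blast
      then show ?thesis by auto
    qed
  qed
  moreover have tr: "transpose_mat S = - S"
    using R by (intro transpose_mat_eq_uminusI[OF S]) blast
  moreover have "S = - transpose_mat S" using S tr by simp
  moreover have "S $$ (i, j) \<noteq> 0" if "i < n" "j < n" "i \<noteq> j" for i j
    using R that by (metis abs_zero zero_neq_one)
  ultimately show "skew_seidel_mat S"
    unfolding skew_seidel_mat_def seidel_mat_def using S d by (metis carrier_matD square_mat.simps)
qed

lemma skew_seidel_matD: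
  assumes "skew_seidel_mat S" "S \<in> carrier_mat n n"
  shows "i < n \<Longrightarrow> j < n \<Longrightarrow> S $$ (j, i) = - S $$ (i, j)"
    and "i < n \<Longrightarrow> S $$ (i, i) = 0"
    and "i < n \<Longrightarrow> j < n \<Longrightarrow> i \<noteq> j \<Longrightarrow> \<bar>S $$ (i, j)\<bar> = 1"
proof -
  have R: "\<forall>i<n. \<forall>j<n. S $$ (j, i) = - S $$ (i, j)" "\<forall>i<n. \<forall>j<n. i \<noteq> j \<longrightarrow> \<bar>S $$ (i, j)\<bar> = 1"
    using assms skew_seidel_mat_iff by blast+
  show "i < n \<Longrightarrow> j < n \<Longrightarrow> S $$ (j, i) = - S $$ (i, j)" using R(1) by blast
  show "i < n \<Longrightarrow> S $$ (i, i) = 0" using R(1) by (metis equal_neg_zero)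
  show "i < n \<Longrightarrow> j < n \<Longrightarrow> i \<noteq> j \<Longrightarrow> \<bar>S $$ (i, j)\<bar> = 1" using R(2) by blast
qed

lemma skew_seidel_mat_obtain_dim:
  assumes "skew_seidel_mat S"
  obtains "S \<in> carrier_mat (degree (char_poly S)) (degree (char_poly S))"
proof -
  have "S \<in> carrier_mat (dim_row S) (dim_row S)"
    using assms by (auto simp: skew_seidel_mat_def seidel_mat_def)
  then show ?thesis using that degree_monic_char_poly by metis
qed

lemma char_poly_uminus_skew:
  assumes "S \<in> carrier_mat n n" "transpose_mat S = - S"
  shows "char_poly (- S) = char_poly S"
  using assms char_poly_transpose_mat by metis

lemma char_poly_matrix_index:
  assumes "S \<in> carrier_mat n n" "i < n" "j < n"
  shows "char_poly_matrix S $$ (i, j) = (if i = j then [:0, 1:] else 0) - [:S $$ (i, j):]"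
  using assms by (auto simp: char_poly_matrix_def)

lemma const_poly_sum: "[:sum f A:] = (\<Sum>i\<in>A. [:f i:])"
  by (rule poly_eqI) (simp add: coeff_sum coeff_pCons split: nat.split)

text \<open>Entrywise form of \<open>(xI - S)(xI + S) = x^2 I - S^2\<close>; the block argument for
  principal submatrices uses it in the first \<open>k\<close> columns only.\<close>

lemma char_poly_matrix_mult_uminus:
  fixes S :: "int mat"
  assumes S: "S \<in> carrier_mat n n" and sq: "S * S = - c \<cdot>\<^sub>m 1\<^sub>m n" and ij: "i < n" "j < n"
  shows "(\<Sum>k<n. char_poly_matrix S $$ (i, k) * char_poly_matrix (- S) $$ (k, j))
       = (if i = j then [:c, 0, 1:] else 0)"
proof -
  let ?x = "[:0, 1:] :: int poly"
  have uS: "- S \<in> carrier_mat n n" using S by simp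
  have "(\<Sum>k<n. char_poly_matrix S $$ (i, k) * char_poly_matrix (- S) $$ (k, j))
     = (\<Sum>k<n. ((if i = k then ?x else 0) - [:S $$ (i, k):]) * ((if k = j then ?x else 0) + [:S $$ (k, j):]))"
    using S ij by (intro sum.cong refl) (simp add: char_poly_matrix_index[OF S] char_poly_matrix_index[OF uS])
  also have "\<dots> = (\<Sum>k<n. (if k = i then (if i = j then ?x * ?x else 0) + ?x * [:S $$ (i, j):] else 0)
      - (if k = j then ?x * [:S $$ (i, j):] else 0) - [:S $$ (i, k) * S $$ (k, j):])"
    by (intro sum.cong refl) (auto simp: algebra_simps)
  also have "\<dots> = (if i = j then ?x * ?x else 0) - (\<Sum>k<n. [:S $$ (i, k) * S $$ (k, j):])"
    using ij by (simp add: sum.distrib sum_subtractf)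
  also have "(\<Sum>k<n. [:S $$ (i, k) * S $$ (k, j):]) = [:(S * S) $$ (i, j):]"
    using S ij by (simp add: const_poly_sum scalar_prod_def lessThan_atLeast0)
  also have "\<dots> = (if i = j then [:- c:] else 0)" unfolding sq using ij by simp
  finally show ?thesis by auto
qed

text \<open>Determinants of \<open>(xI - S)(xI + S) = (x^2 + c) I\<close>; the second factor
  contributes the characteristic polynomial of \<open>- S\<close>, the transpose of
  \<open>S\<close>.\<close>

lemma char_poly_square:
  fixes S :: "int mat"
  assumes S: "S \<in> carrier_mat n n" and t: "transpose_mat S = - S" and sq: "S * S = - c \<cdot>\<^sub>m 1\<^sub>m n"
  shows "(char_poly S)\<^sup>2 = [:c, 0, 1:] ^ n"
proof -
  have C: "char_poly_matrix S \<in> carrier_mat n n" "char_poly_matrix (- S) \<in> carrier_mat n n"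
    using S by auto
  have "char_poly_matrix S * char_poly_matrix (- S) = [:c, 0, 1:] \<cdot>\<^sub>m 1\<^sub>m n"
  proof (rule eq_matI)
    fix i j assume "i < dim_row ([:c, 0, 1:] \<cdot>\<^sub>m 1\<^sub>m n)" "j < dim_col ([:c, 0, 1:] \<cdot>\<^sub>m 1\<^sub>m n)"
    then have ij: "i < n" "j < n" by auto
    have "(char_poly_matrix S * char_poly_matrix (- S)) $$ (i, j)
        = (\<Sum>k<n. char_poly_matrix S $$ (i, k) * char_poly_matrix (- S) $$ (k, j))"
      using C ij by (simp add: scalar_prod_def lessThan_atLeast0)
    then show "(char_poly_matrix S * char_poly_matrix (- S)) $$ (i, j) = ([:c, 0, 1:] \<cdot>\<^sub>m 1\<^sub>m n) $$ (i, j)"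
      using char_poly_matrix_mult_uminus[OF S sq ij] ij by simp
  qed (use C in auto)
  then have "det (char_poly_matrix S * char_poly_matrix (- S)) = [:c, 0, 1:] ^ n"
    by (simp add: det_smult)
  moreover have "det (char_poly_matrix S * char_poly_matrix (- S)) = char_poly S * char_poly (- S)"
    unfolding char_poly_def using S by (intro det_mult[of _ n]) auto
  ultimately show ?thesis using char_poly_uminus_skew[OF S t] by (simp add: power2_eq_square)
qed

text \<open>In an integral domain a square root is unique up to sign, and monicity fixes the
  sign.\<close>

lemma char_poly_eq_power:
  fixes S :: "int mat"
  assumes S: "S \<in> carrier_mat (2 * m) (2 * m)" and t: "transpose_mat S = - S"
    and sq: "S * S = - c \<cdot>\<^sub>m 1\<^sub>m (2 * m)"
  shows "char_poly S = [:c, 0, 1:] ^ m"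
proof -
  let ?q = "[:c, 0, 1:] ^ m :: int poly"
  have "(char_poly S)\<^sup>2 = ?q\<^sup>2" using char_poly_square[OF assms] by (simp add: power_even_eq)
  then have "char_poly S = ?q \<or> char_poly S = - ?q" by (simp add: power2_eq_iff)
  moreover have "char_poly S \<noteq> - ?q"
  proof
    assume "char_poly S = - ?q"
    moreover have "lead_coeff (char_poly S) = 1" using degree_monic_char_poly[OF S] by simp
    moreover have "lead_coeff ?q = 1" by (simp add: lead_coeff_power)
    ultimately show False by simp
  qed
  ultimately show ?thesis by blast
qed

text \<open>Replace all but the first \<open>k\<close> columns of \<open>xI + S\<close> by those of the identity matrix; multiplied by
  \<open>xI - S\<close> from the left, the result is block triangular because \<open>(xI - S)(xI + S) = (x\<^sup>2 + c)I\<close>.\<close>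

lemma char_poly_principal_submatrix:
  fixes S :: "int mat"
  assumes S: "S \<in> carrier_mat (k + m) (k + m)" and t: "transpose_mat S = - S"
    and sq: "S * S = - c \<cdot>\<^sub>m 1\<^sub>m (k + m)"
  defines "T \<equiv> mat k k (\<lambda>ij. S $$ ij)" and "S0 \<equiv> mat m m (\<lambda>(i, j). S $$ (i + k, j + k))"
  shows "char_poly S * char_poly T = [:c, 0, 1:] ^ k * char_poly S0"
proof -
  let ?n = "k + m"
  have uS: "- S \<in> carrier_mat ?n ?n" using S by simp
  have T: "T \<in> carrier_mat k k" and S0: "S0 \<in> carrier_mat m m" by (auto simp: T_def S0_def)
  have uT: "- T \<in> carrier_mat k k" using T by simp
  define N where "N = mat ?n ?n (\<lambda>(i, j). if j < k then char_poly_matrix (- S) $$ (i, j) else if i = j then 1 else 0)"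
  have N: "N \<in> carrier_mat ?n ?n" by (simp add: N_def)
  have C: "char_poly_matrix S \<in> carrier_mat ?n ?n" "char_poly_matrix (- S) \<in> carrier_mat ?n ?n"
    using S by auto
  \<comment> \<open>The last \<open>m\<close> columns are unit vectors supported in the last
    \<open>m\<close> rows, so the upper right block is zero and only \<open>xI + T\<close>
    contributes to the determinant.\<close>
  have "N = four_block_mat (char_poly_matrix (- T)) (0\<^sub>m k m)
          (mat m k (\<lambda>(i, j). char_poly_matrix (- S) $$ (i + k, j))) (1\<^sub>m m)"
    using T S by (intro eq_matI) (auto simp: N_def char_poly_matrix_def T_def)
  then have dN: "det N = char_poly (- T)"
    using uT by (simp add: det_four_block_mat_upper_right_zero[of _ k _ m] char_poly_def)
  have "transpose_mat T = - T"
  proof (rule eq_matI)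
    fix i j assume "i < dim_row (- T)" "j < dim_col (- T)"
    then show "transpose_mat T $$ (i, j) = (- T) $$ (i, j)"
      using arg_cong[OF t, of "\<lambda>M. M $$ (i, j)"] S by (simp add: T_def)
  qed (auto simp: T_def)
  then have dN': "det N = char_poly T" using dN char_poly_uminus_skew[OF T] by simp
  have "char_poly_matrix S * N =
      four_block_mat ([:c, 0, 1:] \<cdot>\<^sub>m 1\<^sub>m k) (mat k m (\<lambda>(i, j). char_poly_matrix S $$ (i, j + k)))
        (0\<^sub>m m k) (char_poly_matrix S0)" (is "_ = ?R")
  proof (rule eq_matI)
    fix i j assume "i < dim_row ?R" "j < dim_col ?R"
    then have ij: "i < ?n" "j < ?n" using char_poly_matrix_closed[OF S0] by auto
    have l: "(char_poly_matrix S * N) $$ (i, j) = (\<Sum>l<?n. char_poly_matrix S $$ (i, l) * N $$ (l, j))"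
      using ij N C by (simp add: scalar_prod_def lessThan_atLeast0)
    show "(char_poly_matrix S * N) $$ (i, j) = ?R $$ (i, j)"
    proof (cases "j < k")
      case True
      have "(char_poly_matrix S * N) $$ (i, j) = (\<Sum>l<?n. char_poly_matrix S $$ (i, l) * char_poly_matrix (- S) $$ (l, j))"
        unfolding l using True by (intro sum.cong refl) (simp add: N_def)
      then show ?thesis
        using char_poly_matrix_mult_uminus[OF S sq ij] True ij char_poly_matrix_closed[OF S0]
        by (cases "i < k") auto
    next
      case False
      have "(char_poly_matrix S * N) $$ (i, j) = (\<Sum>l<?n. if l = j then char_poly_matrix S $$ (i, l) else 0)"
        unfolding l using False ij by (intro sum.cong refl) (simp add: N_def)
      also have "\<dots> = char_poly_matrix S $$ (i, j)" using ij by simp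
      also have "\<dots> = ?R $$ (i, j)"
      proof (cases "i < k")
        case True
        then show ?thesis using False ij char_poly_matrix_closed[OF S0] by simp
      next
        case i: False
        then have "char_poly_matrix S0 $$ (i - k, j - k) = char_poly_matrix S $$ (i, j)"
          using False ij char_poly_matrix_index[OF S0, of "i - k" "j - k"] char_poly_matrix_index[OF S, of i j]
          by (auto simp: S0_def)
        then show ?thesis using i False ij char_poly_matrix_closed[OF S0] by simp
      qed
      finally show ?thesis .
    qed
  qed (use C N char_poly_matrix_closed[OF S0] in auto)
  then have "det (char_poly_matrix S * N) = [:c, 0, 1:] ^ k * char_poly S0"
    using char_poly_matrix_closed[OF S0]
    by (simp add: det_four_block_mat_lower_left_zero[of _ k _ m] det_smult char_poly_def)
  moreover have "det (char_poly_matrix S * N) = char_poly S * det N"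
    unfolding char_poly_def using S N by (intro det_mult[of _ ?n]) auto
  ultimately show ?thesis using dN' by simp
qed

section \<open>Skew Seidel matrices of order at most three\<close>

lemma det_2_mat:
  assumes A: "(A :: 'a :: comm_ring_1 mat) \<in> carrier_mat 2 2"
  shows "det A = A $$ (0, 0) * A $$ (1, 1) - A $$ (1, 0) * A $$ (0, 1)"
proof -
  have d: "mat_delete A i j \<in> carrier_mat 1 1" for i j using A by (auto simp: mat_delete_def)
  have "det A = A $$ (0, 0) * cofactor A 0 0 + A $$ (1, 0) * cofactor A 1 0"
    using laplace_expansion_column[OF A, of 0] by (simp add: numeral_2_eq_2)
  then show ?thesis
    unfolding cofactor_def det_single[OF d] using A by (simp add: mat_delete_def)
qed

lemma det_3_mat:
  assumes A: "(A :: 'a :: comm_ring_1 mat) \<in> carrier_mat 3 3"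
  shows "det A = A $$ (0, 0) * (A $$ (1, 1) * A $$ (2, 2) - A $$ (2, 1) * A $$ (1, 2))
    - A $$ (1, 0) * (A $$ (0, 1) * A $$ (2, 2) - A $$ (2, 1) * A $$ (0, 2))
    + A $$ (2, 0) * (A $$ (0, 1) * A $$ (1, 2) - A $$ (1, 1) * A $$ (0, 2))"
proof -
  have d: "mat_delete A i j \<in> carrier_mat 2 2" for i j using A by (auto simp: mat_delete_def)
  have "det A = A $$ (0, 0) * cofactor A 0 0 + A $$ (1, 0) * cofactor A 1 0 + A $$ (2, 0) * cofactor A 2 0"
    using laplace_expansion_column[OF A, of 0] by (simp add: eval_nat_numeral)
  then show ?thesis
    unfolding cofactor_def det_2_mat[OF d] using A by (simp add: mat_delete_def algebra_simps flip: numeral_2_eq_2)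
qed

lemma abs_1_mult_self: "\<bar>x :: int\<bar> = 1 \<Longrightarrow> x * x = 1"
  by (metis abs_mult_self_eq mult_1)

lemma char_poly_skew_seidel_1:
  assumes "T \<in> carrier_mat 1 1" "skew_seidel_mat T"
  shows "char_poly T = [:0, 1:]"
  using assms skew_seidel_matD[OF assms(2,1)]
  by (simp add: char_poly_def det_single[of _] char_poly_matrix_index)

lemma char_poly_skew_seidel_2:
  assumes T: "T \<in> carrier_mat 2 2" "skew_seidel_mat T"
  shows "char_poly T = [:1, 0, 1:]"
proof -
  note D = skew_seidel_matD[OF T(2,1)]
  have "T $$ (0, 1) * T $$ (0, 1) = 1" using D(3)[of 0 1] by (simp add: abs_1_mult_self)
  then show ?thesis
    using D(1)[of 0 1] D(2)[of 0] D(2)[of 1]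
    by (simp add: char_poly_def det_2_mat[OF char_poly_matrix_closed[OF T(1)]] char_poly_matrix_index[OF T(1)])
qed

text \<open>The two triple products in the determinant cancel by skewness, and the signs otherwise
  enter through squares only. Hence the choice of deleted rows does not affect the result.\<close>

lemma char_poly_skew_seidel_3:
  assumes T: "T \<in> carrier_mat 3 3" "skew_seidel_mat T"
  shows "char_poly T = [:0, 1:] * [:3, 0, 1:]"
proof -
  note D = skew_seidel_matD[OF T(2,1)]
  have "T $$ (0, 1) * T $$ (0, 1) = 1" "T $$ (0, 2) * T $$ (0, 2) = 1" "T $$ (1, 2) * T $$ (1, 2) = 1"
    using D(3)[of 0 1] D(3)[of 0 2] D(3)[of 1 2] by (simp_all add: abs_1_mult_self)
  then show ?thesis
    using D(1)[of 0 1] D(1)[of 0 2] D(1)[of 1 2] D(2)[of 0] D(2)[of 1] D(2)[of 2]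
    by (simp add: char_poly_def det_3_mat[OF char_poly_matrix_closed[OF T(1)]] char_poly_matrix_index[OF T(1)] mult.commute)
qed

section \<open>Bordering\<close>

lemma smult_mat_cancel_int:
  fixes X Y :: "int mat"
  assumes "a \<cdot>\<^sub>m X = a \<cdot>\<^sub>m Y" "a \<noteq> 0" "X \<in> carrier_mat n m" "Y \<in> carrier_mat n m"
  shows "X = Y"
proof (rule eq_matI)
  fix i j assume "i < dim_row Y" "j < dim_col Y"
  then show "X $$ (i, j) = Y $$ (i, j)"
    using arg_cong[OF assms(1), of "\<lambda>M. M $$ (i, j)"] assms(2-) by simp
qed (use assms in auto)

text \<open>For \<open>k = 3\<close> the three squares above the diagonal have all pairwise sums
  equal to 8, so each is 4. The norm \<open>4 (k - 1)\<close> is that of a row of a doubled skew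
  Seidel matrix.\<close>

lemma skew_rows_norm_imp_entries:
  fixes u :: "nat \<Rightarrow> nat \<Rightarrow> int"
  assumes k: "k \<in> {1, 2, 3}" and skew: "\<And>i j. i < k \<Longrightarrow> j < k \<Longrightarrow> u j i = - u i j"
    and norm: "\<And>i. i < k \<Longrightarrow> (\<Sum>j<k. (u i j)\<^sup>2) = 4 * (int k - 1)"
    and ij: "i < k" "j < k" "i \<noteq> j"
  shows "\<bar>u i j\<bar> = 2"
proof -
  have d: "u i i = 0" if "i < k" for i using skew[OF that that] by simp
  have sk: "(u j i)\<^sup>2 = (u i j)\<^sup>2" if "i < k" "j < k" for i j using skew[OF that] by simp
  have "(u i j)\<^sup>2 = 2\<^sup>2"
  proof -
    consider "k = 1" | "k = 2" | "k = 3" using k by auto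
    then show ?thesis
    proof cases
      case 1
      then show ?thesis using ij by simp
    next
      case 2
      then have "(u 0 1)\<^sup>2 = 4" using norm[of 0] d[of 0] by (simp add: numeral_2_eq_2)
      moreover have "(i = 0 \<and> j = 1) \<or> (i = 1 \<and> j = 0)" using ij 2 by auto
      ultimately show ?thesis using sk[of 0 1] 2 by auto
    next
      case 3
      have "(u 0 1)\<^sup>2 + (u 0 2)\<^sup>2 = 8" "(u 0 1)\<^sup>2 + (u 1 2)\<^sup>2 = 8" "(u 0 2)\<^sup>2 + (u 1 2)\<^sup>2 = 8"
        using norm[of 0] norm[of 1] norm[of 2] d[of 0] d[of 1] d[of 2] sk[of 0 1] sk[of 0 2] sk[of 1 2] 3
        by (simp_all add: eval_nat_numeral)
      then have "(u 0 1)\<^sup>2 = 4" "(u 0 2)\<^sup>2 = 4" "(u 1 2)\<^sup>2 = 4" by linarith+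
      moreover have "(i, j) \<in> {(0, 1), (0, 2), (1, 2), (1, 0), (2, 0), (2, 1)}" using ij 3 by auto
      ultimately show ?thesis using sk[of 0 1] sk[of 0 2] sk[of 1 2] 3 by auto
    qed
  qed
  then have "u i j = 2 \<or> u i j = -2" by (simp only: power2_eq_iff)
  then show ?thesis by auto
qed

text \<open>The matrix \<open>Z\<close> witnesses that \<open>A\<close> has full column rank. Since \<open>S\<close> commutes with \<open>A A\<^sup>T\<close>, it maps
  the column space of \<open>A\<close> to itself, so \<open>S A = - A T\<close> for a unique \<open>T\<close>, and \<open>A\<^sup>T A = T\<^sup>2 + c I\<close>
  follows; the row norms then force the off-diagonal entries of \<open>T\<close> to be \<open>\<plusminus>1\<close> because \<open>k \<le> 3\<close>.
  The matrix \<open>U = 2 T\<close> and the factors 2 keep the computation integral.\<close>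

lemma skew_seidel_completion:
  fixes S A Z :: "int mat"
  assumes S: "S \<in> carrier_mat n n" "skew_seidel_mat S"
    and A: "A \<in> carrier_mat n k" and Z: "Z \<in> carrier_mat n k"
    and pm: "\<And>i j. i < n \<Longrightarrow> j < k \<Longrightarrow> \<bar>A $$ (i, j)\<bar> = 1"
    and AA: "A * transpose_mat A = S * S + c \<cdot>\<^sub>m 1\<^sub>m n"
    and AZ: "transpose_mat A * Z = 2 \<cdot>\<^sub>m 1\<^sub>m k"
    and c: "c = int n + int k - 1" and k: "k \<in> {1, 2, 3}"
  shows "\<exists>S'. S' \<in> carrier_mat (k + n) (k + n) \<and> skew_seidel_mat S' \<and> S' * S' = - c \<cdot>\<^sub>m 1\<^sub>m (k + n)"
proof -
  define B where "B = S * S + c \<cdot>\<^sub>m 1\<^sub>m n"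
  define U where "U = - (transpose_mat A * (S * Z))"
  have car: "B \<in> carrier_mat n n" "U \<in> carrier_mat k k" "transpose_mat A \<in> carrier_mat k n"
    "transpose_mat Z \<in> carrier_mat k n"
    using S A Z by (auto simp: B_def U_def)
  have sk: "transpose_mat S = - S" using S by (simp add: skew_seidel_mat_def)
  have BS: "B * S = S * B"
    using S by (simp add: B_def add_mult_distrib_mat[of _ n n _ _ n] mult_add_distrib_mat[of _ n n _ n]
        assoc_mult_mat[of _ n n _ n _ n] mult_smult_assoc_mat[of _ n n _ n] mult_smult_distrib[of _ n n _ n])
  have BZ: "B * Z = 2 \<cdot>\<^sub>m A"
  proof -
    have "B * Z = A * (transpose_mat A * Z)"
      using A Z by (simp add: B_def AA[symmetric] assoc_mult_mat[of _ n k _ n _ k])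
    then show ?thesis unfolding AZ using A by (simp add: mult_smult_distrib[of _ n k _ k])
  qed
  \<comment> \<open>Origin of \<open>U\<close>: as \<open>2 A = B Z\<close> and \<open>S\<close>
    commutes with \<open>B\<close>, one gets \<open>2 S A = B S Z = A (A^T S Z)\<close>.\<close>
  have SA: "2 \<cdot>\<^sub>m (S * A) = - (A * U)"
  proof -
    have "2 \<cdot>\<^sub>m (S * A) = S * (B * Z)" unfolding BZ using S A by (simp add: mult_smult_distrib[of _ n n _ k])
    also have "\<dots> = B * (S * Z)"
      unfolding assoc_mult_mat[OF S(1) car(1) Z, symmetric] BS[symmetric]
      by (rule assoc_mult_mat[OF car(1) S(1) Z])
    also have "\<dots> = A * (transpose_mat A * (S * Z))"
      unfolding B_def AA[symmetric] using A Z S by (intro assoc_mult_mat[of _ n k _ n _ k]) auto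
    also have "\<dots> = - (A * U)" using A Z S by (simp add: U_def)
    finally show ?thesis .
  qed
  have ZA: "transpose_mat Z * A = 2 \<cdot>\<^sub>m 1\<^sub>m k"
  proof -
    have "transpose_mat Z * A = transpose_mat (transpose_mat A * Z)"
      using A Z by (simp add: transpose_mult[of _ k n _ k])
    also have "\<dots> = 2 \<cdot>\<^sub>m 1\<^sub>m k" unfolding AZ by (intro eq_matI) auto
    finally show ?thesis .
  qed
  \<comment> \<open>The transpose of \<open>U\<close> is \<open>Z^T S A\<close>; multiplying
    \<open>2 S A = - A U\<close> by \<open>Z^T\<close> from the left turns the right side into
    \<open>- 2 U\<close>.\<close>
  have Uskew: "transpose_mat U = - U"
  proof -
    have "transpose_mat (S * Z) = - (transpose_mat Z * S)"
      using S Z sk by (simp add: transpose_mult[of _ n n _ k])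
    then have "transpose_mat U = transpose_mat Z * S * A"
      using A Z S unfolding U_def by (simp add: transpose_uminus transpose_mult[of _ k n _ k])
    then have "2 \<cdot>\<^sub>m transpose_mat U = transpose_mat Z * (2 \<cdot>\<^sub>m (S * A))"
      using A Z S car by (simp add: assoc_mult_mat[of _ k n _ n _ k] mult_smult_distrib[of _ k n _ k])
    also have "\<dots> = - (transpose_mat Z * A * U)"
      unfolding SA using A Z car by (simp add: assoc_mult_mat[of _ k n _ k _ k])
    also have "\<dots> = 2 \<cdot>\<^sub>m (- U)" unfolding ZA using car by (auto simp: mult_smult_assoc_mat[of _ k k _ k])
    finally show ?thesis by (rule smult_mat_cancel_int[where n = k and m = k]) (use car in auto)
  qed
  \<comment> \<open>Both sides agree after multiplication by \<open>A\<close>, because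
    \<open>4 S^2 A = A U^2\<close>; then \<open>Z^T\<close> cancels \<open>A\<close> up to the
    factor 2.\<close>
  have AtA: "4 \<cdot>\<^sub>m (transpose_mat A * A) = U * U + (4 * c) \<cdot>\<^sub>m 1\<^sub>m k"
  proof -
    have "A * (4 \<cdot>\<^sub>m (transpose_mat A * A)) = 4 \<cdot>\<^sub>m (B * A)"
      using A by (simp add: B_def AA[symmetric] assoc_mult_mat[of _ n k _ n _ k] mult_smult_distrib[of _ n k _ k])
    also have "\<dots> = 2 \<cdot>\<^sub>m (S * (2 \<cdot>\<^sub>m (S * A))) + (4 * c) \<cdot>\<^sub>m A"
      using S A unfolding B_def
      by (intro eq_matI) (auto simp: add_mult_distrib_mat[of _ n n _ _ k] assoc_mult_mat[of _ n n _ n _ k]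
          mult_smult_distrib[of _ n n _ k] mult_smult_assoc_mat[of _ n n _ k])
    also have "S * (2 \<cdot>\<^sub>m (S * A)) = - (S * A * U)"
      unfolding SA using S A car by (simp add: assoc_mult_mat[of _ n n _ k _ k])
    also have "2 \<cdot>\<^sub>m (- (S * A * U)) = - (2 \<cdot>\<^sub>m (S * A) * U)"
      using S A car by (intro eq_matI) (auto simp: mult_smult_assoc_mat[of _ n k _ k])
    also have "\<dots> = A * (U * U)"
      unfolding SA using A car by (simp add: assoc_mult_mat[of _ n k _ k _ k])
    also have "A * (U * U) + (4 * c) \<cdot>\<^sub>m A = A * (U * U + (4 * c) \<cdot>\<^sub>m 1\<^sub>m k)"
      using A car by (simp add: mult_add_distrib_mat[of _ n k _ k] mult_smult_distrib[of _ n k _ k])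
    finally have "transpose_mat Z * (A * (4 \<cdot>\<^sub>m (transpose_mat A * A)))
      = transpose_mat Z * (A * (U * U + (4 * c) \<cdot>\<^sub>m 1\<^sub>m k))" by simp
    then have "(transpose_mat Z * A) * (4 \<cdot>\<^sub>m (transpose_mat A * A))
      = (transpose_mat Z * A) * (U * U + (4 * c) \<cdot>\<^sub>m 1\<^sub>m k)"
      using A car by (simp add: assoc_mult_mat[of _ k n _ k _ k])
    then have "2 \<cdot>\<^sub>m (4 \<cdot>\<^sub>m (transpose_mat A * A)) = 2 \<cdot>\<^sub>m (U * U + (4 * c) \<cdot>\<^sub>m 1\<^sub>m k)"
      unfolding ZA using A car by (simp add: mult_smult_assoc_mat[of _ k k _ k])
    then show ?thesis by (rule smult_mat_cancel_int[where n = k and m = k]) (use A car in auto)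
  qed
  have u_skew: "U $$ (j, i) = - U $$ (i, j)" if "i < k" "j < k" for i j
    using arg_cong[OF Uskew, of "\<lambda>M. M $$ (i, j)"] that car by simp
  \<comment> \<open>The columns of \<open>A\<close> have squared norm \<open>n\<close>, so the
    diagonal of \<open>AtA\<close> leaves \<open>4 (c - n) = 4 (k - 1)\<close>.\<close>
  have u_norm: "(\<Sum>j<k. (U $$ (i, j))\<^sup>2) = 4 * (int k - 1)" if i: "i < k" for i
  proof -
    have "(transpose_mat A * A) $$ (i, i) = (\<Sum>l<n. A $$ (l, i) * A $$ (l, i))"
      using A i by (simp add: scalar_prod_def lessThan_atLeast0)
    also have "\<dots> = int n" using pm i by (simp add: abs_1_mult_self)
    finally have "4 * int n = (U * U) $$ (i, i) + 4 * c"
      using arg_cong[OF AtA, of "\<lambda>M. M $$ (i, i)"] i A car by simp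
    also have "(U * U) $$ (i, i) = (\<Sum>l<k. U $$ (i, l) * U $$ (l, i))"
      using car i by (simp add: scalar_prod_def lessThan_atLeast0)
    also have "\<dots> = - (\<Sum>l<k. (U $$ (i, l))\<^sup>2)"
      unfolding sum_negf[symmetric] using u_skew[OF i]
      by (intro sum.cong refl) (simp add: power2_eq_square)
    finally show ?thesis using c by simp
  qed
  have u_abs: "\<bar>U $$ (i, j)\<bar> = 2" if "i < k" "j < k" "i \<noteq> j" for i j
    using skew_rows_norm_imp_entries[of k "\<lambda>i j. U $$ (i, j)" i j] u_skew u_norm k that by blast
  have u_diag: "U $$ (i, i) = 0" if "i < k" for i using u_skew[OF that that] by simp
  \<comment> \<open>The division is exact: the entries of \<open>U\<close> are 0 on the diagonal and
    2 or -2 elsewhere.\<close>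
  define T where "T = mat k k (\<lambda>ij. U $$ ij div 2)"
  have T: "T \<in> carrier_mat k k" by (simp add: T_def)
  have UT: "U $$ (i, j) = 2 * T $$ (i, j)" if "i < k" "j < k" for i j
  proof (cases "i = j")
    case True then show ?thesis using that u_diag by (simp add: T_def)
  next
    case False
    then have "U $$ (i, j) = 2 \<or> U $$ (i, j) = -2" using u_abs[OF that False] by linarith
    then show ?thesis using that by (auto simp: T_def)
  qed
  then have U_T: "U = 2 \<cdot>\<^sub>m T" using car T by (intro eq_matI) auto
  have t_skew: "T $$ (j, i) = - T $$ (i, j)" if "i < k" "j < k" for i j
    using u_skew[OF that] UT that by simp
  have t_abs: "\<bar>T $$ (i, j)\<bar> = 1" if "i < k" "j < k" "i \<noteq> j" for i j
    using u_abs[OF that] UT[OF that(1,2)] by simp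
  have SA': "S * A = - (A * T)"
  proof (rule smult_mat_cancel_int[of 2])
    show "2 \<cdot>\<^sub>m (S * A) = 2 \<cdot>\<^sub>m - (A * T)"
      unfolding SA U_T using A T by (intro eq_matI) (auto simp: mult_smult_distrib[of _ n k _ k])
  qed (use S A T in auto)
  have AtA': "transpose_mat A * A = T * T + c \<cdot>\<^sub>m 1\<^sub>m k"
  proof (rule smult_mat_cancel_int[of 4])
    show "4 \<cdot>\<^sub>m (transpose_mat A * A) = 4 \<cdot>\<^sub>m (T * T + c \<cdot>\<^sub>m 1\<^sub>m k)"
      unfolding AtA U_T using T
      by (intro eq_matI) (auto simp: mult_smult_distrib[of _ k k _ k] mult_smult_assoc_mat[of _ k k _ k])
  qed (use A T in auto)
  have TA: "T * transpose_mat A = - (transpose_mat A * S)"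
  proof -
    have "transpose_mat T = - T" by (rule transpose_mat_eq_uminusI[OF T t_skew])
    then have "transpose_mat (- (A * T)) = T * transpose_mat A"
      using A T by (simp add: transpose_uminus transpose_mult[of _ n k _ k])
    moreover have "transpose_mat (S * A) = - (transpose_mat A * S)"
      using A S sk by (simp add: transpose_mult[of _ n n _ k])
    ultimately show ?thesis using SA' by simp
  qed
  \<comment> \<open>The opposite signs of the borders make \<open>S'\<close> skew; the off-diagonal
    blocks of its square, \<open>T A^T + A^T S\<close> and \<open>- (A T + S A)\<close>, vanish by
    \<open>TA\<close> and \<open>SA'\<close>.\<close>
  define S' where "S' = four_block_mat T (transpose_mat A) (- A) S"
  have S': "S' \<in> carrier_mat (k + n) (k + n)" using T S by (simp add: S'_def)
  have "S' * S' = four_block_mat (T * T + transpose_mat A * (- A)) (T * transpose_mat A + transpose_mat A * S)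
       ((- A) * T + S * (- A)) ((- A) * transpose_mat A + S * S)"
    unfolding S'_def using T A S by (intro mult_four_block_mat[of _ k k _ n _ n]) auto
  also have "T * T + transpose_mat A * (- A) = - c \<cdot>\<^sub>m 1\<^sub>m k"
  proof -
    have "transpose_mat A * (- A) = - (T * T + c \<cdot>\<^sub>m 1\<^sub>m k)" using A AtA' by simp
    then show ?thesis using T by (intro eq_matI) auto
  qed
  also have "T * transpose_mat A + transpose_mat A * S = 0\<^sub>m k n"
    unfolding TA using A S by (intro eq_matI) auto
  also have "(- A) * T + S * (- A) = 0\<^sub>m n k"
  proof -
    have "S * (- A) = A * T" using S A T SA' by simp
    then show ?thesis using A T by (intro eq_matI) auto
  qed
  also have "(- A) * transpose_mat A + S * S = - c \<cdot>\<^sub>m 1\<^sub>m n"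
  proof -
    have "(- A) * transpose_mat A = - (S * S + c \<cdot>\<^sub>m 1\<^sub>m n)" using A AA by simp
    then show ?thesis using S by (intro eq_matI) auto
  qed
  also have "four_block_mat (- c \<cdot>\<^sub>m 1\<^sub>m k) (0\<^sub>m k n) (0\<^sub>m n k) (- c \<cdot>\<^sub>m 1\<^sub>m n) = - c \<cdot>\<^sub>m 1\<^sub>m (k + n)"
    by (intro eq_matI) auto
  finally have "S' * S' = - c \<cdot>\<^sub>m 1\<^sub>m (k + n)" .
  moreover have "skew_seidel_mat S'"
    unfolding skew_seidel_mat_iff[OF S']
  proof (intro conjI allI impI)
    fix i j assume ij: "i < k + n" "j < k + n"
    show "S' $$ (j, i) = - S' $$ (i, j)"
      using ij T S A t_skew[of i j] skew_seidel_matD(1)[OF S(2,1), of "i - k" "j - k"]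
      by (cases "i < k"; cases "j < k") (simp_all add: S'_def)
    show "\<bar>S' $$ (i, j)\<bar> = 1" if "i \<noteq> j"
      using ij that T S A t_abs[of i j] skew_seidel_matD(3)[OF S(2,1), of "i - k" "j - k"]
        pm[of "i - k" j] pm[of "j - k" i]
      by (cases "i < k"; cases "j < k") (simp_all add: S'_def)
  qed
  ultimately show ?thesis using S' by blast
qed

section \<open>Gram matrices of sign vectors\<close>

text \<open>The form \<open>b\<close> is the Gram matrix of \<open>\<plusminus>1\<close> vectors \<open>a i\<close> of length \<open>k\<close>; the dual system \<open>z\<close> ensures
  that the \<open>k\<close> columns of \<open>a\<close> are linearly independent.\<close>

definition sign_factorisable :: "(nat \<Rightarrow> nat \<Rightarrow> int) \<Rightarrow> nat \<Rightarrow> nat \<Rightarrow> bool" where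
  "sign_factorisable b n k \<longleftrightarrow> (\<exists>a z. (\<forall>i<n. \<forall>r<k. \<bar>a i r\<bar> = 1) \<and>
     (\<forall>i<n. \<forall>j<n. b i j = (\<Sum>r<k. a i r * a j r)) \<and>
     (\<forall>r<k. \<forall>s<k. (\<Sum>i<n. a i r * z i s) = (if r = s then 2 else 0)))"

section \<open>Integer multiples of orthogonal projections\<close>

lemma sum_square_combination:
  fixes x y :: "nat \<Rightarrow> int"
  shows "(\<Sum>k\<in>A. (x k + s * y k)\<^sup>2)
    = (\<Sum>k\<in>A. x k * x k) + 2 * s * (\<Sum>k\<in>A. x k * y k) + s\<^sup>2 * (\<Sum>k\<in>A. y k * y k)"
proof -
  have "(\<Sum>k\<in>A. (x k + s * y k)\<^sup>2) = (\<Sum>k\<in>A. x k * x k + 2 * s * (x k * y k) + s\<^sup>2 * (y k * y k))"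
    by (intro sum.cong refl) (simp add: power2_eq_square algebra_simps)
  then show ?thesis by (simp only: sum.distrib sum_distrib_left)
qed

text \<open>The matrix of \<open>g\<close> is \<kappa> times an orthogonal projection, so \<kappa>
  times it is the Gram matrix of its own rows. This gives the inequality for two indices, and in the
  case of equality a combination of rows of norm zero, hence proportional rows.\<close>

locale scaled_projection =
  fixes g :: "nat \<Rightarrow> nat \<Rightarrow> int" and n :: nat and \<kappa> :: int
  assumes sym: "i < n \<Longrightarrow> j < n \<Longrightarrow> g i j = g j i"
    and mult: "i < n \<Longrightarrow> j < n \<Longrightarrow> (\<Sum>k<n. g i k * g k j) = \<kappa> * g i j"
    and pos: "\<kappa> > 0"
begin

lemma inner_rows: "i < n \<Longrightarrow> j < n \<Longrightarrow> (\<Sum>k<n. g i k * g j k) = \<kappa> * g i j"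
  unfolding mult[symmetric] by (intro sum.cong refl) (simp add: sym)

lemma norm_combination:
  assumes "i < n" "j < n"
  shows "(\<Sum>k<n. (g i k + s * g j k)\<^sup>2) = \<kappa> * (g i i + 2 * s * g i j + s\<^sup>2 * g j j)"
  unfolding sum_square_combination using assms by (simp add: inner_rows algebra_simps)

lemma combination_nonneg:
  assumes "i < n" "j < n"
  shows "0 \<le> g i i + 2 * s * g i j + s\<^sup>2 * g j j"
proof -
  have "0 \<le> \<kappa> * (g i i + 2 * s * g i j + s\<^sup>2 * g j j)"
    unfolding norm_combination[OF assms, symmetric] by (simp add: sum_nonneg)
  then show ?thesis using pos by (simp add: zero_le_mult_iff)
qed

lemma rows_proportional:
  assumes "i < n" "j < n" "g i i + 2 * s * g i j + s\<^sup>2 * g j j = 0" "k < n"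
  shows "g i k = - s * g j k"
proof -
  have "(\<Sum>k<n. (g i k + s * g j k)\<^sup>2) = 0" using norm_combination[OF assms(1,2)] assms(3) by simp
  then have "(g i k + s * g j k)\<^sup>2 = 0" using assms(4) by (simp add: sum_nonneg_eq_0_iff)
  then show ?thesis by simp
qed

end

lemma scaled_projection_cong:
  assumes g: "scaled_projection g n \<kappa>" and eq: "\<And>i j. i < n \<Longrightarrow> j < n \<Longrightarrow> g i j = h i j"
  shows "scaled_projection h n \<kappa>"
proof
  interpret scaled_projection g n \<kappa> by fact
  show "0 < \<kappa>" by (rule pos)
  fix i j assume ij: "i < n" "j < n"
  show "h i j = h j i" using sym[OF ij] eq ij by simp
  have "(\<Sum>k<n. h i k * h k j) = (\<Sum>k<n. g i k * g k j)" using eq ij by (intro sum.cong refl) simp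
  then show "(\<Sum>k<n. h i k * h k j) = \<kappa> * h i j" using mult[OF ij] eq[OF ij] by simp
qed

text \<open>Each row has squared norm \<open>n\<close> and consists of \<open>n\<close> odd entries,
  so all entries are 1 or -1. Any two rows then agree up to sign, and row 0 serves as the single
  column.\<close>

lemma sign_factorisable_1:
  assumes "scaled_projection b n (int n)" and diag: "\<And>i. i < n \<Longrightarrow> b i i = 1"
    and nz: "\<And>i j. i < n \<Longrightarrow> j < n \<Longrightarrow> odd (b i j)"
  shows "sign_factorisable b n 1"
proof -
  interpret scaled_projection b n "int n" by fact
  have n: "0 < n" using pos by simp
  have b2: "1 \<le> (b i j)\<^sup>2" if "i < n" "j < n" for i j
    using nz[OF that] by (metis even_zero not_less one_le_numeral power2_less_eq_zero_iff zero_less_power2 int_one_le_iff_zero_less)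
  have b1: "b i j = 1 \<or> b i j = -1" if "i < n" "j < n" for i j
  proof -
    have "(\<Sum>k<n. (b i k)\<^sup>2 - 1) = 0"
      using inner_rows[OF that(1) that(1)] diag[OF that(1)] by (simp add: sum_subtractf power2_eq_square)
    moreover have "0 \<le> (b i k)\<^sup>2 - 1" if "k < n" for k using b2[OF \<open>i < n\<close> that] by linarith
    ultimately have "(b i j)\<^sup>2 - 1 = 0" using that by (subst (asm) sum_nonneg_eq_0_iff) auto
    then show ?thesis by (simp add: power2_eq_1_iff)
  qed
  have fac: "b i j = b 0 i * b 0 j" if ij: "i < n" "j < n" for i j
  proof -
    have sq: "b k l * b k l = 1" if "k < n" "l < n" for k l using b1[OF that] by auto
    \<comment> \<open>For \<open>s = - b i j\<close> the form \<open>1 + 2 s b i j + s^2\<close>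
      vanishes, so row \<open>i\<close> is \<open>b i j\<close> times row \<open>j\<close>.\<close>
    have "b i 0 = - (- b i j) * b j 0"
      using sq[OF ij] by (intro rows_proportional ij n) (simp add: diag ij power2_eq_square mult.assoc)
    then have "b 0 i * b 0 j = b i j * (b j 0 * b j 0)"
      using sym[OF ij(1) n] sym[OF ij(2) n] by simp
    then show ?thesis using sq[OF ij(2) n] by simp
  qed
  have "(\<Sum>i<n. b 0 i * (if i = 0 then 2 else 0)) = (\<Sum>i<n. if i = 0 then 2 * b 0 i else 0)"
    by (intro sum.cong refl) simp
  then have z: "(\<Sum>i<n. b 0 i * (if i = 0 then 2 else 0)) = 2" using n diag[OF n] by simp
  have abs: "\<bar>b 0 i\<bar> = 1" if "i < n" for i using b1[OF n that] by auto
  show ?thesis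
    unfolding sign_factorisable_def
  proof (rule exI[of _ "\<lambda>i _. b 0 i"], rule exI[of _ "\<lambda>i _. if i = 0 then 2 else 0"], intro conjI allI impI)
    fix i j assume "i < n" "j < n"
    from fac[OF this] show "b i j = (\<Sum>r<1::nat. b 0 i * b 0 j)" by simp
  qed (use abs z in auto)
qed

text \<open>In \<open>c = b div 2\<close> any two rows are equal up to sign or have disjoint supports of half the size; if
  \<open>u\<close> and \<open>v\<close> are two disjoint rows, then \<open>c = u u\<^sup>T + v v\<^sup>T\<close>, so \<open>u + v\<close> and \<open>u - v\<close> serve as columns.\<close>

lemma sign_factorisable_2:
  assumes "scaled_projection b n (int n)" and diag: "\<And>i. i < n \<Longrightarrow> b i i = 2"
    and ev: "\<And>i j. i < n \<Longrightarrow> j < n \<Longrightarrow> even (b i j)" and n: "n = 2 * m"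
  shows "sign_factorisable b n 2"
proof -
  interpret B: scaled_projection b n "int n" by fact
  define c where "c = (\<lambda>i j. b i j div 2)"
  have bc: "b i j = 2 * c i j" if "i < n" "j < n" for i j using ev[OF that] by (simp add: c_def)
  have m: "m > 0" using B.pos n by simp
  interpret scaled_projection c n "int m"
  proof
    fix i j assume ij: "i < n" "j < n"
    show "c i j = c j i" using B.sym[OF ij] by (simp add: c_def)
    have "(\<Sum>k<n. b i k * b k j) = (\<Sum>k<n. 4 * (c i k * c k j))"
      using ij by (intro sum.cong refl) (simp add: bc)
    then show "(\<Sum>k<n. c i k * c k j) = int m * c i j"
      using B.mult[OF ij] n by (simp add: bc[OF ij] flip: sum_distrib_left)
  qed (use m in simp)
  have d: "c i i = 1" if "i < n" for i using diag[OF that] by (simp add: c_def)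
  \<comment> \<open>The Gram inequality with \<open>s = 1\<close> and \<open>s = -1\<close> bounds
    the entries by the diagonal value 1; a nonzero entry is then the equality case.\<close>
  have c01: "c i j = 0 \<or> c i j = 1 \<or> c i j = -1" if "i < n" "j < n" for i j
    using combination_nonneg[OF that, of 1] combination_nonneg[OF that, of "-1"] d that by auto
  have row: "c i k = c i j * c j k" if "i < n" "j < n" "k < n" "c i j \<noteq> 0" for i j k
    using rows_proportional[OF that(1,2), of "- c i j" k] c01[OF that(1,2)] d that by auto
  have nrm: "(\<Sum>k<n. (c i k)\<^sup>2) = int m" if "i < n" for i
    using inner_rows[OF that that] d[OF that] by (simp add: power2_eq_square)
  have n0: "0 < n" using n m by simp
  \<comment> \<open>Row 0 has squared norm \<open>m\<close>, so it cannot have \<open>2 m\<close>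
    nonzero entries.\<close>
  obtain j where j: "j < n" "c 0 j = 0"
  proof (rule ccontr)
    assume "\<not> thesis"
    then have "c 0 k \<noteq> 0" if "k < n" for k using \<open>\<And>j. j < n \<Longrightarrow> c 0 j = 0 \<Longrightarrow> thesis\<close> that by blast
    then have "(c 0 k)\<^sup>2 = 1" if "k < n" for k using c01[OF n0 that] that by auto
    then have "(\<Sum>k<n. (c 0 k)\<^sup>2) = int n" by simp
    then show False using nrm[OF n0] n m by simp
  qed
  have disj: "c 0 i = 0 \<or> c j i = 0" if i: "i < n" for i
  proof (rule ccontr)
    assume "\<not> ?thesis"
    then have "c 0 j = c 0 i * c i j" "c 0 i \<noteq> 0" "c i j \<noteq> 0"
      using row[OF n0 i j(1)] sym[OF i j(1)] by auto
    then show False using j by simp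
  qed
  \<comment> \<open>Two disjoint supports of size \<open>m\<close> exhaust the \<open>2 m\<close>
    indices.\<close>
  have cover: "(c 0 i)\<^sup>2 + (c j i)\<^sup>2 = 1" if i: "i < n" for i
  proof -
    have "(\<Sum>k<n. 1 - ((c 0 k)\<^sup>2 + (c j k)\<^sup>2)) = 0"
      using nrm[OF n0] nrm[OF j(1)] n by (simp add: sum_subtractf sum.distrib)
    moreover have "0 \<le> 1 - ((c 0 k)\<^sup>2 + (c j k)\<^sup>2)" if "k < n" for k
      using disj[OF that] c01[OF n0 that] c01[OF j(1) that] by auto
    ultimately have "1 - ((c 0 i)\<^sup>2 + (c j i)\<^sup>2) = 0"
      using i by (subst (asm) sum_nonneg_eq_0_iff) auto
    then show ?thesis by simp
  qed
  have fac: "c i k = c 0 i * c 0 k + c j i * c j k" if i: "i < n" and k: "k < n" for i k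
    using disj[OF i] cover[OF i] row[OF i n0 k] row[OF i j(1) k] sym[OF i n0] sym[OF i j(1)]
    by (cases "c 0 i = 0"; cases "c j i = 0") simp_all
  define a where "a = (\<lambda>i r :: nat. if r = 0 then c 0 i + c j i else c 0 i - c j i)"
  \<comment> \<open>Row 0 of \<open>a\<close> is \<open>(1, 1)\<close> and row \<open>j\<close> is
    \<open>(1, -1)\<close>; their sum and difference are twice the unit vectors.\<close>
  define z where "z = (\<lambda>i r :: nat. (if i = 0 then 1 else 0) + (if i = j then if r = 0 then 1 else -1 else 0) :: int)"
  have "\<bar>a i r\<bar> = 1" if "i < n" for i r
    using disj[OF that] cover[OF that] c01[OF n0 that] c01[OF j(1) that] by (auto simp: a_def)
  moreover have "b i k = (\<Sum>r<2. a i r * a k r)" if "i < n" "k < n" for i k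
    using fac[OF that] bc[OF that] by (simp add: a_def numeral_2_eq_2 algebra_simps)
  moreover have "(\<Sum>i<n. a i r * z i s) = (if r = s then 2 else 0)" if "r < 2" "s < 2" for r s
  proof -
    have "(\<Sum>i<n. a i r * z i s) = (\<Sum>i<n. (if i = 0 then a i r else 0) + (if i = j then a i r * (if s = 0 then 1 else -1) else 0))"
      by (intro sum.cong refl) (simp add: z_def)
    also have "\<dots> = a 0 r + a j r * (if s = 0 then 1 else -1)"
      using n0 j by (simp add: sum.distrib)
    also have "\<dots> = (if r = s then 2 else 0)"
      using j d[OF n0] d[OF j(1)] sym[OF j(1) n0] that by (auto simp: a_def)
    finally show ?thesis .
  qed
  ultimately show ?thesis unfolding sign_factorisable_def by blast
qed

text \<open>With \<open>B\<close> the matrix of \<open>b\<close>, of eigenvalues \<open>4t + 3\<close>, \<open>4t\<close> (twice) and 0, the two hypotheses concern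
  \<open>B((4t + 3)I - B)\<close> and \<open>B(B - 4tI)\<close>, multiples of spectral projections. The first makes \<open>b\<close> behave
  like a Gram matrix of vectors of squared norm 3: rows \<open>i\<close> and \<open>j\<close> with \<open>\<bar>b i j\<bar> = 3\<close> agree up to sign.
  The second, together with its trace, shows that the resulting classes have sizes \<open>t + 1\<close>, \<open>t\<close>, \<open>t\<close>, \<open>t\<close>,
  and that up to signs their representatives are the four diagonals of a cube.\<close>

lemma sign_factorisable_3:
  fixes b :: "nat \<Rightarrow> nat \<Rightarrow> int" and t :: nat
  defines "bb \<equiv> \<lambda>i j. \<Sum>k<4 * t + 1. b i k * b k j"
  assumes G: "scaled_projection (\<lambda>i j. (4 * int t + 3) * b i j - bb i j) (4 * t + 1) (12 * int t)"
    and E: "scaled_projection (\<lambda>i j. bb i j - 4 * int t * b i j) (4 * t + 1) (3 * (4 * int t + 3))"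
    and sym: "\<And>i j. i < 4 * t + 1 \<Longrightarrow> j < 4 * t + 1 \<Longrightarrow> b i j = b j i"
    and diag: "\<And>i. i < 4 * t + 1 \<Longrightarrow> b i i = 3"
    and odd: "\<And>i j. i < 4 * t + 1 \<Longrightarrow> j < 4 * t + 1 \<Longrightarrow> odd (b i j)"
    and trace: "(\<Sum>i<4 * t + 1. bb i i - 4 * int t * b i i) = 3 * (4 * int t + 3)"
  shows "sign_factorisable b (4 * t + 1) 3"
proof -
  define n where "n = 4 * t + 1"
  note sym = sym[folded n_def] and diag = diag[folded n_def]
    and odd = odd[folded n_def] and trace = trace[folded n_def] and bb_def = bb_def[folded n_def]
  interpret G: scaled_projection "\<lambda>i j. (4 * int t + 3) * b i j - bb i j" n "12 * int t"
    unfolding n_def by (rule G)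
  interpret E: scaled_projection "\<lambda>i j. bb i j - 4 * int t * b i j" n "3 * (4 * int t + 3)"
    unfolding n_def by (rule E)
  have t: "t > 0" using G.pos by simp
  have bb: "bb i j = (\<Sum>k<n. b i k * b j k)" if "i < n" "j < n" for i j
    unfolding bb_def using that by (intro sum.cong refl) (simp add: sym)
  \<comment> \<open>Nonnegativity of the first form at the combination of \<open>i\<close> and
    \<open>j\<close> with coefficient \<open>s\<close>, rewritten as an upper bound for the norm of
    a combination of rows of \<open>b\<close>.\<close>
  have norm: "(\<Sum>k<n. (b i k + s * b j k)\<^sup>2) \<le> (4 * int t + 3) * (6 + 2 * s * b i j)"
    if ij: "i < n" "j < n" and s: "s\<^sup>2 = 1" for i j s
  proof -
    have "(\<Sum>k<n. (b i k + s * b j k)\<^sup>2) = bb i i + 2 * s * bb i j + s\<^sup>2 * bb j j"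
      unfolding sum_square_combination using ij by (simp add: bb)
    then show ?thesis
      using G.combination_nonneg[OF ij, of s] s by (simp add: diag ij algebra_simps)
  qed
  have le3: "\<bar>b i j\<bar> \<le> 3" if "i < n" "j < n" for i j
  proof -
    have "0 \<le> (4 * int t + 3) * (6 + 2 * s * b i j)" if "s\<^sup>2 = 1" for s
      using norm[OF \<open>i < n\<close> \<open>j < n\<close> that] by (meson order_trans sum_nonneg zero_le_power2)
    from this[of 1] this[of "-1"] show ?thesis by (simp add: zero_le_mult_iff)
  qed
  have vals: "b i j = 1 \<or> b i j = -1 \<or> b i j = 3 \<or> b i j = -3" if "i < n" "j < n" for i j
    using le3[OF that] odd[OF that] by presburger
  define K where "K = (\<lambda>i. {j. j < n \<and> \<bar>b i j\<bar> = 3})"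
  have row: "\<exists>\<epsilon>. \<epsilon>\<^sup>2 = 1 \<and> (\<forall>k<n. b j k = \<epsilon> * b i k)" if i: "i < n" and j: "j \<in> K i" for i j
  proof -
    obtain e where e: "e\<^sup>2 = 1" "b i j = 3 * e"
    proof -
      have "b i j = 3 * 1 \<or> b i j = 3 * (-1)" using j by (auto simp: K_def)
      then show ?thesis using that by force
    qed
    have ji: "j < n" using j by (simp add: K_def)
    have "e * e = 1" using e(1) by (simp add: power2_eq_square)
    then have "(\<Sum>k<n. (b j k + (-e) * b i k)\<^sup>2) \<le> 0"
      using norm[OF ji i, of "-e"] e sym[OF i ji] by simp
    then have "(\<Sum>k<n. (b j k + (-e) * b i k)\<^sup>2) = 0" by (simp add: order_antisym sum_nonneg)
    then have "b j k = e * b i k" if "k < n" for k using that by (simp add: sum_nonneg_eq_0_iff)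
    then show ?thesis using e by blast
  qed
  have K_eq: "K j = K i" if i: "i < n" and j: "j \<in> K i" for i j
  proof -
    obtain e where e: "e\<^sup>2 = 1" "\<forall>k<n. b j k = e * b i k" using row[OF i j] by blast
    have "\<bar>e\<bar> = 1" using e(1) by (simp add: power2_eq_1_iff abs_eq_iff')
    then show ?thesis using e(2) by (auto simp: K_def abs_mult)
  qed
  have self: "i \<in> K i" if "i < n" for i using that diag by (simp add: K_def)
  have fin: "finite (K i)" for i by (simp add: K_def)
  have Ksub: "K i \<subseteq> {..<n}" for i by (auto simp: K_def)
  have K_disj: "K i \<inter> K j = {}" if "i < n" "j < n" "j \<notin> K i" for i j
    using K_eq self that by blast
  define m where "m = (\<lambda>i. int (card (K i)))"
  \<comment> \<open>Row \<open>i\<close> has \<open>m i\<close> entries of square 9, and all others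
    have square 1.\<close>
  have Eii: "bb i i - 4 * int t * b i i = 8 * m i - 8 * int t + 1" if i: "i < n" for i
  proof -
    have "bb i i = (\<Sum>k<n. 1 + (if k \<in> K i then 8 else 0))"
      unfolding bb[OF i i]
    proof (intro sum.cong refl)
      fix k assume "k \<in> {..<n}"
      then show "b i k * b i k = 1 + (if k \<in> K i then 8 else 0)"
        using vals[OF i, of k] by (auto simp: K_def)
    qed
    also have "\<dots> = int n + 8 * m i"
      using Ksub[of i] by (simp add: sum.distrib m_def sum.If_cases Int_absorb1)
    finally show ?thesis using diag[OF i] by (simp add: n_def)
  qed
  \<comment> \<open>By integrality, \<open>8 (m i - t) + 1 \<ge> 0\<close> already gives
    \<open>m i \<ge> t\<close>.\<close>
  have m_ge: "int t \<le> m i" if i: "i < n" for i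
    using E.combination_nonneg[OF i i, of 0] Eii[OF i] by simp
  have m_sum: "(\<Sum>i<n. m i - int t) = int t + 1"
  proof -
    have "(\<Sum>i<n. 8 * (m i - int t) + 1) = 3 * (4 * int t + 3)"
      unfolding trace[symmetric] using Eii by (intro sum.cong refl) simp
    then have "8 * (\<Sum>i<n. m i - int t) + int n = 3 * (4 * int t + 3)"
      by (simp add: sum.distrib sum_distrib_left)
    then show ?thesis by (simp add: n_def)
  qed
  obtain z where z: "z < n" "m z > int t"
  proof (rule ccontr)
    assume "\<not> thesis"
    then have "m i - int t = 0" if "i < n" for i using m_ge[OF that] \<open>\<And>z. z < n \<Longrightarrow> m z > int t \<Longrightarrow> thesis\<close> that by force
    then show False using m_sum by simp
  qed
  have m_eq: "m i = m j" if "j < n" "i \<in> K j" for i j using K_eq[OF that] by (simp add: m_def)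
  \<comment> \<open>Since \<open>m\<close> is constant on classes, the class of \<open>z\<close>
    alone contributes \<open>m z (m z - t)\<close> to a total of \<open>t + 1\<close>. This forces
    \<open>m z = t + 1\<close> and leaves nothing for the other classes.\<close>
  have split: "(\<Sum>i<n. m i - int t) = m z * (m z - int t) + (\<Sum>i\<in>{..<n} - K z. m i - int t)"
  proof -
    have "(\<Sum>i\<in>K z. m i - int t) = m z * (m z - int t)"
      using m_eq[OF z(1)] by (simp add: m_def)
    then show ?thesis using sum.subset_diff[OF Ksub[of z], of "\<lambda>i. m i - int t"] by simp
  qed
  have rest: "0 \<le> (\<Sum>i\<in>{..<n} - K z. m i - int t)" by (intro sum_nonneg) (auto dest: m_ge)
  have mz: "m z = int t + 1"
  proof (rule ccontr)
    assume "m z \<noteq> int t + 1"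
    then have "(int t + 2) * 2 \<le> m z * (m z - int t)" using z by (intro mult_mono) auto
    then show False using split rest m_sum by simp
  qed
  then have rest0: "(\<Sum>i\<in>{..<n} - K z. m i - int t) = 0" using split m_sum by simp
  have m_t: "m i = int t" if "i < n" "i \<notin> K z" for i
  proof -
    have "m i - int t = 0" using rest0 that by (subst (asm) sum_nonneg_eq_0_iff) (auto dest: m_ge)
    then show ?thesis by simp
  qed
  have ex_outside: "\<exists>i<n. i \<notin> A" if "A \<subseteq> {..<n}" "card A < n" for A
  proof -
    have "A \<noteq> {..<n}" using that by auto
    then show ?thesis using that by blast
  qed
  have cz: "card (K z) = t + 1" using mz by (simp add: m_def)
  obtain w1 where w1: "w1 < n" "w1 \<notin> K z"
    using ex_outside[OF Ksub[of z]] cz t by (auto simp: n_def)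
  have c1: "card (K w1) = t" using m_t[OF w1] by (simp add: m_def)
  have d1: "K z \<inter> K w1 = {}" using K_disj z w1 by blast
  have u1: "card (K z \<union> K w1) = 2 * t + 1" using d1 cz c1 fin by (simp add: card_Un_disjoint)
  obtain w2 where w2: "w2 < n" "w2 \<notin> K z \<union> K w1"
    using ex_outside[of "K z \<union> K w1"] Ksub u1 t by (auto simp: n_def)
  have c2: "card (K w2) = t" using m_t w2 by (simp add: m_def)
  have d2: "(K z \<union> K w1) \<inter> K w2 = {}" using K_disj z w1 w2 by blast
  have u2: "card (K z \<union> K w1 \<union> K w2) = 3 * t + 1"
    using d2 u1 c2 fin by (subst card_Un_disjoint) auto
  obtain w3 where w3: "w3 < n" "w3 \<notin> K z \<union> K w1 \<union> K w2"
    using ex_outside[of "K z \<union> K w1 \<union> K w2"] Ksub u2 t by (auto simp: n_def)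
  have c3: "card (K w3) = t" using m_t w3 by (simp add: m_def)
  have d3: "(K z \<union> K w1 \<union> K w2) \<inter> K w3 = {}" using K_disj z w1 w2 w3 by blast
  have u3: "card (K z \<union> K w1 \<union> K w2 \<union> K w3) = n"
    using d3 u2 c3 fin by (subst card_Un_disjoint) (auto simp: n_def)
  have all: "K z \<union> K w1 \<union> K w2 \<union> K w3 = {..<n}"
    using u3 Ksub by (intro card_subset_eq) auto
  have sum_split: "(\<Sum>k<n. f k) = (\<Sum>k\<in>K z. f k) + (\<Sum>k\<in>K w1. f k) + (\<Sum>k\<in>K w2. f k) + (\<Sum>k\<in>K w3. f k)"
    for f :: "nat \<Rightarrow> int"
    unfolding all[symmetric] using d1 d2 d3 fin by (simp add: sum.union_disjoint)
  have class_sum: "(\<Sum>k\<in>K w. b i k * b j k) = m w * (b i w * b j w)" if "i < n" "j < n" "w < n" for i j w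
  proof -
    have "b i k * b j k = b i w * b j w" if k: "k \<in> K w" for k
    proof -
      obtain e where e: "e\<^sup>2 = 1" "\<forall>l<n. b k l = e * b w l" using row[OF \<open>w < n\<close> k] by blast
      have kn: "k < n" using k by (simp add: K_def)
      have "b i k = e * b i w" "b j k = e * b j w"
        using e(2) \<open>i < n\<close> \<open>j < n\<close> sym[OF \<open>i < n\<close> kn] sym[OF \<open>j < n\<close> kn]
          sym[OF \<open>i < n\<close> \<open>w < n\<close>] sym[OF \<open>j < n\<close> \<open>w < n\<close>] by auto
      then have "b i k * b j k = e\<^sup>2 * (b i w * b j w)" by (simp add: power2_eq_square)
      then show ?thesis using e(1) by simp
    qed
    then show ?thesis by (simp add: m_def)
  qed
  have one: "b i j = 1 \<or> b i j = -1" if "i < n" "j < n" "j \<notin> K i" for i j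
    using vals[OF that(1,2)] that by (auto simp: K_def)
  \<comment> \<open>The second form has diagonal value 9 at \<open>z\<close> and 1 at
    \<open>i\<close>; the coefficients 3 and -3 balance the two and give the bound
    \<open>sqrt (9 * 1)\<close>.\<close>
  have Ez: "\<bar>bb z i - 4 * int t * b z i\<bar> \<le> 3" if i: "i < n" "i \<notin> K z" for i
    using E.combination_nonneg[OF z(1) i(1), of 3] E.combination_nonneg[OF z(1) i(1), of "-3"]
      Eii[OF z(1)] Eii[OF i(1)] mz m_t[OF i] by simp
  have bz: "bb z i = (int t + 1) * (3 * b z i) + int t * (b z w1 * b i w1) + int t * (b z w2 * b i w2) + int t * (b z w3 * b i w3)"
    if i: "i < n" for i
    unfolding bb[OF z(1) i] sum_split
    using class_sum[OF z(1) i] z w1 w2 w3 mz m_t diag sym[OF i z(1)] by simp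
  \<comment> \<open>The products \<open>p q\<close> and \<open>p' q'\<close> must both equal
    \<open>- r\<close>: otherwise the absolute value is \<open>2 t + 3\<close> or
    \<open>4 t + 3\<close>, which exceeds 3.\<close>
  have sign: "p * q = - r" if "\<bar>(2 * int t + 3) * r + int t * (p * q + p' * q')\<bar> \<le> 3"
    and pm: "p = 1 \<or> p = -1" "q = 1 \<or> q = -1" "p' = 1 \<or> p' = -1" "q' = 1 \<or> q' = -1" "r = 1 \<or> r = -1"
    for p q p' q' r :: int
    using that t by (elim disjE) (simp_all add: algebra_simps)
  have notin: "z \<notin> K w1" "w1 \<notin> K z" "w2 \<notin> K z" "w3 \<notin> K z" "w2 \<notin> K w1" "w3 \<notin> K w1" "w3 \<notin> K w2"
    using w1 w2 w3 d1 self[OF z(1)] by auto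
  note ones = one[OF z(1) w1(1)] one[OF z(1) w2(1)] one[OF z(1) w3(1)]
    one[OF w1(1) w2(1)] one[OF w1(1) w3(1)] one[OF w2(1) w3(1)]
  note syms = sym[OF w2(1) w1(1)] sym[OF w3(1) w1(1)] sym[OF w3(1) w2(1)]
    sym[OF w1(1) z(1)] sym[OF w2(1) z(1)] sym[OF w3(1) z(1)]
  have s12: "b z w2 * b w1 w2 = - b z w1"
    using Ez[OF w1(1)] bz[OF w1(1)] diag[OF w1(1)] ones notin syms
    by (intro sign[where p' = "b z w3" and q' = "b w1 w3"]) (simp_all add: algebra_simps)
  have s13: "b z w3 * b w1 w3 = - b z w1"
    using Ez[OF w1(1)] bz[OF w1(1)] diag[OF w1(1)] ones notin syms
    by (intro sign[where p' = "b z w2" and q' = "b w1 w2"]) (simp_all add: algebra_simps)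
  have s23: "b z w3 * b w2 w3 = - b z w2"
    using Ez[OF w2(1)] bz[OF w2(1)] diag[OF w2(1)] ones notin syms
    by (intro sign[where p' = "b z w1" and q' = "b w2 w1"]) (simp_all add: algebra_simps)
  define w where "w = (\<lambda>r :: nat. if r = 0 then w1 else if r = 1 then w2 else w3)"
  have w_n: "w r < n" for r using w1 w2 w3 by (simp add: w_def)
  define \<tau> where "\<tau> = (\<lambda>r. b z (w r))"
  have bzw: "b z (w r) = \<tau> r" for r by (simp add: \<tau>_def)
  have \<tau>: "\<tau> r = 1 \<or> \<tau> r = -1" for r using ones notin by (simp add: \<tau>_def w_def)
  then have \<tau>_abs: "\<bar>\<tau> r\<bar> = 1" for r by (metis abs_1 abs_minus_cancel)
  have \<tau>\<tau>: "\<tau> r * \<tau> r = 1" for r using \<tau>[of r] by auto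
  have b_ww: "b (w r) (w s) = (if r = s then 3 else - (\<tau> r * \<tau> s))" if "r < 3" "s < 3" for r s
  proof -
    have "b w1 w2 = - (b z w1 * b z w2)" "b w1 w3 = - (b z w1 * b z w3)" "b w2 w3 = - (b z w2 * b z w3)"
      using s12 s13 s23 ones notin by auto
    moreover have "r = 0 \<or> r = 1 \<or> r = 2" "s = 0 \<or> s = 1 \<or> s = 2" using that by auto
    ultimately show ?thesis
      using syms diag w1 w2 w3 by (elim disjE) (simp_all add: w_def \<tau>_def mult.commute)
  qed
  \<comment> \<open>In the cube model \<open>z\<close> is the all-one vector and
    \<open>\<tau> r\<close> times \<open>w r\<close> differs from it in coordinate \<open>r\<close>
    only. Hence \<open>z - \<tau> r w r\<close> is twice a unit vector, and its inner product with
    vector \<open>i\<close> is \<open>2 a i r\<close>.\<close>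
  define a where "a = (\<lambda>i r. (b z i - \<tau> r * b (w r) i) div 2)"
  have a_z: "a z r = 1" if "r < 3" for r
    using \<tau>\<tau>[of r] diag[OF z(1)] sym[OF w_n[of r] z(1)] bzw[of r] by (simp add: a_def)
  have a_w: "a (w s) r = (if r = s then - \<tau> s else \<tau> s)" if "r < 3" "s < 3" for r s
    using b_ww[OF that] bzw[of s] \<tau>[of r] by (auto simp: a_def)
  define R where "R = {z, w 0, w 1, w 2}"
  have rep: "\<exists>\<rho>\<in>R. \<exists>\<epsilon>. (\<epsilon> = 1 \<or> \<epsilon> = -1) \<and> (\<forall>k<n. b i k = \<epsilon> * b \<rho> k)" if i: "i < n" for i
  proof -
    have "\<exists>\<rho>\<in>R. i \<in> K \<rho>" using all i by (auto simp: R_def w_def)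
    then obtain \<rho> where \<rho>: "\<rho> \<in> R" "i \<in> K \<rho>" by blast
    have "\<rho> < n" using \<rho>(1) z w_n by (auto simp: R_def)
    from row[OF this \<rho>(2)] show ?thesis using \<rho>(1) by (auto simp: power2_eq_1_iff)
  qed
  have a_rep: "a i r = \<epsilon> * a \<rho> r" if "i < n" "\<rho> < n" "\<epsilon> = 1 \<or> \<epsilon> = -1" "\<forall>k<n. b i k = \<epsilon> * b \<rho> k" for i \<rho> \<epsilon> r
  proof -
    have e: "b z i = \<epsilon> * b z \<rho>" "b (w r) i = \<epsilon> * b (w r) \<rho>"
      using that sym[OF z(1) that(1)] sym[OF z(1) that(2)] sym[OF w_n that(1)] sym[OF w_n that(2)] z w_n by auto
    \<comment> \<open>Evenness of the numerator lets \<open>div 2\<close> commute with the sign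
      \<epsilon>.\<close>
    have "even (b z \<rho> - \<tau> r * b (w r) \<rho>)"
      using odd[OF z(1) that(2)] odd[OF w_n that(2)] \<tau>[of r] by auto
    then obtain x where x: "b z \<rho> - \<tau> r * b (w r) \<rho> = 2 * x" by (elim evenE)
    have "b z i - \<tau> r * b (w r) i = \<epsilon> * (b z \<rho> - \<tau> r * b (w r) \<rho>)" unfolding e by (simp add: algebra_simps)
    then show ?thesis by (simp add: a_def x)
  qed
  have Rn: "\<rho> < n" if "\<rho> \<in> R" for \<rho> using that z w_n by (auto simp: R_def)
  have fac_R: "b \<rho> \<rho>' = (\<Sum>r<3. a \<rho> r * a \<rho>' r)" if "\<rho> \<in> R" "\<rho>' \<in> R" for \<rho> \<rho>'
  proof -
    have sum3: "(\<Sum>r<3. f r) = f 0 + f 1 + f 2" for f :: "nat \<Rightarrow> int" by (simp add: eval_nat_numeral)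
    have zz: "b z z = (\<Sum>r<3. a z r * a z r)" unfolding sum3 using a_z diag[OF z(1)] by simp
    have zw: "b z (w s) = (\<Sum>r<3. a z r * a (w s) r)" if "s < 3" for s
    proof -
      have "s = 0 \<or> s = 1 \<or> s = 2" using that by auto
      then show ?thesis unfolding sum3 bzw using a_z a_w by auto
    qed
    have wz: "b (w s) z = (\<Sum>r<3. a (w s) r * a z r)" if "s < 3" for s
      using zw[OF that] sym[OF w_n z(1)] by (simp add: mult.commute)
    have ww: "b (w s) (w s') = (\<Sum>r<3. a (w s) r * a (w s') r)" if "s < 3" "s' < 3" for s s'
    proof -
      have "s = 0 \<or> s = 1 \<or> s = 2" "s' = 0 \<or> s' = 1 \<or> s' = 2" using that by auto
      then show ?thesis unfolding sum3 b_ww[OF that] using \<tau>\<tau> by (elim disjE) (simp_all add: a_w)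
    qed
    have three: "0 < (3 :: nat)" "1 < (3 :: nat)" "2 < (3 :: nat)" by simp_all
    have "\<rho> = z \<or> (\<exists>s<3. \<rho> = w s)" "\<rho>' = z \<or> (\<exists>s<3. \<rho>' = w s)"
      using that three unfolding R_def by blast+
    then show ?thesis using zz zw wz ww by blast
  qed
  have "\<bar>a i r\<bar> = 1" if ir: "i < n" "r < 3" for i r
  proof -
    obtain \<rho> \<epsilon> where \<rho>: "\<rho> \<in> R" "\<epsilon> = 1 \<or> \<epsilon> = -1" "\<forall>k<n. b i k = \<epsilon> * b \<rho> k" using rep[OF ir(1)] by blast
    have "\<bar>a \<rho> r\<bar> = 1"
      using \<rho>(1) a_z[OF ir(2)] a_w[OF ir(2)] \<tau>_abs unfolding R_def by auto
    then show ?thesis using a_rep[OF ir(1) Rn[OF \<rho>(1)] \<rho>(2,3)] \<rho>(2) by auto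
  qed
  moreover have "b i j = (\<Sum>r<3. a i r * a j r)" if ij: "i < n" "j < n" for i j
  proof -
    obtain \<rho> \<epsilon> where \<rho>: "\<rho> \<in> R" "\<epsilon> = 1 \<or> \<epsilon> = -1" "\<forall>k<n. b i k = \<epsilon> * b \<rho> k" using rep[OF ij(1)] by blast
    obtain \<rho>' \<epsilon>' where \<rho>': "\<rho>' \<in> R" "\<epsilon>' = 1 \<or> \<epsilon>' = -1" "\<forall>k<n. b j k = \<epsilon>' * b \<rho>' k" using rep[OF ij(2)] by blast
    have "b i j = \<epsilon> * b j \<rho>" using \<rho>(3) ij sym[OF Rn[OF \<rho>(1)] ij(2)] by simp
    also have "\<dots> = \<epsilon> * \<epsilon>' * b \<rho>' \<rho>" using \<rho>'(3) Rn[OF \<rho>(1)] by simp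
    also have "\<dots> = (\<Sum>r<3. a i r * a j r)"
      unfolding fac_R[OF \<rho>'(1) \<rho>(1)] a_rep[OF ij(1) Rn[OF \<rho>(1)] \<rho>(2,3)] a_rep[OF ij(2) Rn[OF \<rho>'(1)] \<rho>'(2,3)]
      by (simp add: sum_distrib_left algebra_simps)
    finally show ?thesis .
  qed
  \<comment> \<open>The dual system is again \<open>z - \<tau> s w s\<close>, twice the unit vector
    with index \<open>s\<close>.\<close>
  moreover have "(\<Sum>i<n. a i r * ((if i = z then 1 else 0) - (if i = w s then \<tau> s else 0))) = (if r = s then 2 else 0)"
    if "r < 3" "s < 3" for r s
  proof -
    have "(\<Sum>i<n. a i r * ((if i = z then 1 else 0) - (if i = w s then \<tau> s else 0)))
        = (\<Sum>i<n. (if i = z then a i r else 0) - (if i = w s then a i r * \<tau> s else 0))"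
      by (intro sum.cong refl) (simp add: algebra_simps)
    also have "\<dots> = a z r - a (w s) r * \<tau> s" using z w_n by (simp add: sum_subtractf)
    finally show ?thesis using a_z a_w \<tau>\<tau> that by simp
  qed
  ultimately show ?thesis
    unfolding sign_factorisable_def n_def[symmetric]
    by (intro exI[of _ a] exI[of _ "\<lambda>i s. (if i = z then 1 else 0) - (if i = w s then \<tau> s else 0)"]) blast
qed

section \<open>The spectrum of skew Seidel matrices\<close>

lemma sqr_shift_index:
  assumes "S \<in> carrier_mat n n" "i < n" "j < n"
  shows "(S * S + c \<cdot>\<^sub>m 1\<^sub>m n) $$ (i, j) = (\<Sum>k<n. S $$ (i, k) * S $$ (k, j)) + (if i = j then c else 0 :: int)"
  using assms by (simp add: scalar_prod_def lessThan_atLeast0)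

lemma skew_seidel_sqr_shift_sym:
  assumes S: "S \<in> carrier_mat n n" "skew_seidel_mat S" and ij: "i < n" "j < n"
  shows "(S * S + c \<cdot>\<^sub>m 1\<^sub>m n) $$ (i, j) = (S * S + c \<cdot>\<^sub>m 1\<^sub>m n) $$ (j, i)"
proof -
  have "(\<Sum>k<n. S $$ (i, k) * S $$ (k, j)) = (\<Sum>k<n. S $$ (j, k) * S $$ (k, i))"
    using skew_seidel_matD(1)[OF S(2,1) ij(1)] skew_seidel_matD(1)[OF S(2,1) _ ij(2)]
    by (intro sum.cong refl) (simp add: mult.commute)
  then show ?thesis
    unfolding sqr_shift_index[OF S(1) ij] sqr_shift_index[OF S(1) ij(2,1)] by simp
qed

text \<open>Each of the \<open>n - 1\<close> products off the diagonal is -1. For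
  \<open>c = n + k - 1\<close> the value is \<open>k\<close>, the squared norm of a sign vector of
  length \<open>k\<close>.\<close>

lemma skew_seidel_sqr_shift_diag:
  assumes S: "S \<in> carrier_mat n n" "skew_seidel_mat S" and i: "i < n"
  shows "(S * S + c \<cdot>\<^sub>m 1\<^sub>m n) $$ (i, i) = c - (int n - 1)"
proof -
  have "S $$ (i, k) * S $$ (k, i) = (if k = i then 1 else 0) - 1" if k: "k < n" for k
    using skew_seidel_matD(1)[OF S(2,1) i k] skew_seidel_matD(2)[OF S(2,1) i]
      abs_1_mult_self[OF skew_seidel_matD(3)[OF S(2,1) i k]] by auto
  then have "(\<Sum>k<n. S $$ (i, k) * S $$ (k, i)) = (\<Sum>k<n. (if k = i then 1 else 0) - 1)"
    by (intro sum.cong refl) simp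
  then show ?thesis unfolding sqr_shift_index[OF S(1) i i] using i by (simp add: sum_subtractf)
qed

text \<open>The sum has \<open>n - 2\<close> odd terms; the terms at \<open>i\<close> and
  \<open>j\<close> vanish with the diagonal of \<open>S\<close>.\<close>

lemma skew_seidel_sqr_shift_parity:
  assumes S: "S \<in> carrier_mat n n" "skew_seidel_mat S" and ij: "i < n" "j < n" "i \<noteq> j"
  shows "even ((S * S + c \<cdot>\<^sub>m 1\<^sub>m n) $$ (i, j)) \<longleftrightarrow> even n"
proof -
  have odd_abs: "odd x" if "\<bar>x\<bar> = 1" for x :: int using that by presburger
  have "even (\<Sum>k<n. S $$ (i, k) * S $$ (k, j) - (1 - (if k = i then 1 else 0) - (if k = j then 1 else 0)))"
  proof (rule dvd_sum)
    fix k assume "k \<in> {..<n}"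
    then have k: "k < n" by simp
    show "even (S $$ (i, k) * S $$ (k, j) - (1 - (if k = i then 1 else 0) - (if k = j then 1 else 0)))"
    proof (cases "k = i \<or> k = j")
      case True
      then show ?thesis using skew_seidel_matD(2)[OF S(2,1)] ij by auto
    next
      case False
      then have "odd (S $$ (i, k))" "odd (S $$ (k, j))"
        using skew_seidel_matD(3)[OF S(2,1)] odd_abs ij k by blast+
      then show ?thesis using False by simp
    qed
  qed
  also have "(\<Sum>k<n. S $$ (i, k) * S $$ (k, j) - (1 - (if k = i then 1 else 0) - (if k = j then 1 else 0)))
    = (\<Sum>k<n. S $$ (i, k) * S $$ (k, j)) - (int n - 2)"
    using ij by (simp add: sum_subtractf)
  finally show ?thesis unfolding sqr_shift_index[OF S(1) ij(1,2)] using ij(3) by simp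
qed

lemma sign_factorisable_imp_completion:
  fixes S :: "int mat"
  assumes S: "S \<in> carrier_mat n n" "skew_seidel_mat S" and k: "k \<in> {1, 2, 3}" and c: "c = int n + int k - 1"
    and fac: "sign_factorisable (\<lambda>i j. (S * S + c \<cdot>\<^sub>m 1\<^sub>m n) $$ (i, j)) n k"
  shows "\<exists>S'. S' \<in> carrier_mat (k + n) (k + n) \<and> skew_seidel_mat S' \<and> S' * S' = - c \<cdot>\<^sub>m 1\<^sub>m (k + n)"
proof -
  obtain a z :: "nat \<Rightarrow> nat \<Rightarrow> int" where a: "\<forall>i<n. \<forall>r<k. \<bar>a i r\<bar> = 1"
    and b: "\<forall>i<n. \<forall>j<n. (S * S + c \<cdot>\<^sub>m 1\<^sub>m n) $$ (i, j) = (\<Sum>r<k. a i r * a j r)"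
    and z: "\<forall>r<k. \<forall>s<k. (\<Sum>i<n. a i r * z i s) = (if r = s then 2 else 0)"
    using fac unfolding sign_factorisable_def by blast
  define A where "A = mat n k (\<lambda>(i, r). a i r)"
  define Z where "Z = mat n k (\<lambda>(i, r). z i r)"
  have A: "A \<in> carrier_mat n k" and Z: "Z \<in> carrier_mat n k" by (auto simp: A_def Z_def)
  have "A * transpose_mat A = S * S + c \<cdot>\<^sub>m 1\<^sub>m n"
  proof (rule eq_matI)
    fix i j assume "i < dim_row (S * S + c \<cdot>\<^sub>m 1\<^sub>m n)" "j < dim_col (S * S + c \<cdot>\<^sub>m 1\<^sub>m n)"
    then have ij: "i < n" "j < n" by auto
    have "(A * transpose_mat A) $$ (i, j) = (\<Sum>r<k. a i r * a j r)"
      using ij by (simp add: A_def scalar_prod_def lessThan_atLeast0)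
    then show "(A * transpose_mat A) $$ (i, j) = (S * S + c \<cdot>\<^sub>m 1\<^sub>m n) $$ (i, j)" using b ij by simp
  qed (use A in auto)
  moreover have "transpose_mat A * Z = 2 \<cdot>\<^sub>m 1\<^sub>m k"
  proof (rule eq_matI)
    fix r s assume "r < dim_row (2 \<cdot>\<^sub>m 1\<^sub>m k :: int mat)" "s < dim_col (2 \<cdot>\<^sub>m 1\<^sub>m k :: int mat)"
    then have rs: "r < k" "s < k" by auto
    have "(transpose_mat A * Z) $$ (r, s) = (\<Sum>i<n. a i r * z i s)"
      using rs by (simp add: A_def Z_def scalar_prod_def lessThan_atLeast0)
    then show "(transpose_mat A * Z) $$ (r, s) = (2 \<cdot>\<^sub>m 1\<^sub>m k) $$ (r, s)" using z rs by simp
  qed (use A Z in auto)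
  moreover have "\<bar>A $$ (i, j)\<bar> = 1" if "i < n" "j < k" for i j using a that by (simp add: A_def)
  ultimately show ?thesis using skew_seidel_completion[OF S A Z _ _ _ c k] by blast
qed

section \<open>Quadratic relations from eigenvalues\<close>

context triangularising
begin

text \<open>The matrix \<open>M^2 - \<kappa> M\<close> is symmetric and triangularised with zero
  diagonal, hence zero. This stands in for diagonalising \<open>M\<close>.\<close>

lemma triangularised_scaled_projection:
  assumes M: "triangularised P Q n M f" and sym: "\<And>i j. i < n \<Longrightarrow> j < n \<Longrightarrow> M $$ (i, j) = M $$ (j, i)"
    and f: "\<And>i. i < n \<Longrightarrow> f i * f i = of_int \<kappa> * f i" and pos: "\<kappa> > 0"
  shows "scaled_projection (\<lambda>i j. M $$ (i, j)) n \<kappa>"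
proof
  fix i j assume ij: "i < n" "j < n"
  show "M $$ (i, j) = M $$ (j, i)" by (rule sym[OF ij])
  have c: "M \<in> carrier_mat n n" using M by (simp add: triangularised_def)
  have X: "triangularised P Q n (M * M + (- \<kappa>) \<cdot>\<^sub>m M) (\<lambda>i. f i * f i + of_int (- \<kappa>) * f i)"
    by (intro triangularised_add triangularised_mult triangularised_smult M)
  have idx: "(M * M + (- \<kappa>) \<cdot>\<^sub>m M) $$ (i, j) = (\<Sum>k<n. M $$ (i, k) * M $$ (k, j)) - \<kappa> * M $$ (i, j)"
    if "i < n" "j < n" for i j
    using c that by (simp add: scalar_prod_def lessThan_atLeast0)
  have sq: "(\<Sum>k<n. M $$ (i, k) * M $$ (k, j)) = (\<Sum>k<n. M $$ (j, k) * M $$ (k, i))" if "i < n" "j < n" for i j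
  proof (intro sum.cong refl)
    fix k assume "k \<in> {..<n}"
    then show "M $$ (i, k) * M $$ (k, j) = M $$ (j, k) * M $$ (k, i)"
      using sym[of i k] sym[of k j] that by simp
  qed
  have "(M * M + (- \<kappa>) \<cdot>\<^sub>m M) $$ (i, j) = 0"
  proof (rule triangularised_symmetric_eq_0[OF X _ _ ij])
    fix i j assume ij: "i < n" "j < n"
    show "(M * M + (- \<kappa>) \<cdot>\<^sub>m M) $$ (i, j) = (M * M + (- \<kappa>) \<cdot>\<^sub>m M) $$ (j, i)"
      unfolding idx[OF ij] idx[OF ij(2,1)] using sq[OF ij] sym[OF ij] by simp
  next
    fix i assume "i < n"
    then show "f i * f i + of_int (- \<kappa>) * f i = 0" using f by simp
  qed
  then show "(\<Sum>k<n. M $$ (i, k) * M $$ (k, j)) = \<kappa> * M $$ (i, j)" using idx[OF ij] by simp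
qed (rule pos)

end

lemma skew_seidel_eigenvalues:
  assumes "skew_seidel_mat S" and deg: "degree (char_poly S) = n"
  obtains P Q e where "S \<in> carrier_mat n n" "triangularising P Q n" "triangularised P Q n S e"
    "\<And>i. i < n \<Longrightarrow> poly (map_poly of_int (char_poly S)) (e i) = 0"
proof -
  have S: "S \<in> carrier_mat n n" using skew_seidel_mat_obtain_dim[OF assms(1)] deg by metis
  show ?thesis
    using that S char_poly_eigenvalues[OF S] by (metis triangularising.intro)
qed

lemma (in triangularising) triangularised_sqr_shift:
  assumes "triangularised P Q n S e"
  shows "triangularised P Q n (S * S + c \<cdot>\<^sub>m 1\<^sub>m n) (\<lambda>i. e i * e i + of_int c)"
  using triangularised_add[OF triangularised_mult[OF assms assms] triangularised_smult[OF triangularised_one, of c]]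
  by simp

lemma poly_of_int_X: "poly (map_poly of_int [:0, 1:]) x = (x :: complex)"
  by simp

lemma poly_of_int_quadratic: "poly (map_poly of_int [:a, 0, 1:]) x = x * x + (of_int a :: complex)"
  by simp

lemma degree_times_quadratic_power:
  "p \<noteq> 0 \<Longrightarrow> degree (p * [:c, 0, 1:] ^ m :: int poly) = degree p + 2 * m"
  by (simp add: degree_mult_eq degree_power_eq)

text \<open>Every eigenvalue has square \<open>- c\<close>, so the symmetric matrix
  \<open>S^2 + c I\<close> is triangularised with zero diagonal.\<close>

lemma skew_seidel_sqr_eq:
  assumes S: "skew_seidel_mat S" and cp: "char_poly S = [:c, 0, 1:] ^ m"
  shows "S \<in> carrier_mat (2 * m) (2 * m)" "S * S = - c \<cdot>\<^sub>m 1\<^sub>m (2 * m)"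
proof -
  let ?n = "2 * m"
  have "degree (char_poly S) = ?n" by (simp add: cp degree_power_eq)
  then obtain P Q e where car: "S \<in> carrier_mat ?n ?n" and tr: "triangularising P Q ?n"
    and e: "triangularised P Q ?n S e"
    and roots: "\<And>i. i < ?n \<Longrightarrow> poly (map_poly of_int (char_poly S)) (e i) = 0"
    using skew_seidel_eigenvalues[OF S] by metis
  interpret triangularising P Q ?n by fact
  have e0: "e i * e i + of_int c = 0" if "i < ?n" for i
    using roots[OF that] unfolding cp of_int_poly_hom.hom_power poly_power poly_of_int_quadratic by auto
  have "(S * S + c \<cdot>\<^sub>m 1\<^sub>m ?n) $$ (i, j) = 0" if "i < ?n" "j < ?n" for i j
    using triangularised_symmetric_eq_0[OF triangularised_sqr_shift[OF e] skew_seidel_sqr_shift_sym[OF car S] e0 that] .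
  then have "S * S + c \<cdot>\<^sub>m 1\<^sub>m ?n = 0\<^sub>m ?n ?n" using car by (intro eq_matI) auto
  moreover have "S * S = (S * S + c \<cdot>\<^sub>m 1\<^sub>m ?n) + - c \<cdot>\<^sub>m 1\<^sub>m ?n"
    using car by (intro eq_matI) auto
  ultimately show "S * S = - c \<cdot>\<^sub>m 1\<^sub>m ?n" by (simp add: left_add_zero_mat[of _ ?n ?n])
  show "S \<in> carrier_mat ?n ?n" by fact
qed

text \<open>The identity for complementary principal submatrices becomes
  \<open>(x^2 + c)^m p = (x^2 + c)^k \<chi>\<close>, and the power cancels. The hypothesis on all
  \<open>T\<close> of order \<open>k\<close> makes it irrelevant which block is removed.\<close>

lemma skew_seidel_delete:
  assumes S: "skew_seidel_mat S" and cp: "char_poly S = [:c, 0, 1:] ^ m" and k: "k \<le> m"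
    and T: "\<And>T. T \<in> carrier_mat k k \<Longrightarrow> skew_seidel_mat T \<Longrightarrow> char_poly T = p"
  shows "\<exists>S'. skew_seidel_mat S' \<and> char_poly S' = p * [:c, 0, 1:] ^ (m - k)"
proof -
  define l where "l = 2 * m - k"
  have l: "2 * m = k + l" using k by (simp add: l_def)
  have car: "S \<in> carrier_mat (k + l) (k + l)" and sq: "S * S = - c \<cdot>\<^sub>m 1\<^sub>m (k + l)"
    using skew_seidel_sqr_eq[OF S cp] l by auto
  define T where "T = mat k k (\<lambda>ij. S $$ ij)"
  define S' where "S' = mat l l (\<lambda>(i, j). S $$ (i + k, j + k))"
  have tr: "transpose_mat S = - S" using S by (simp add: skew_seidel_mat_def)
  have T: "T \<in> carrier_mat k k" and S': "S' \<in> carrier_mat l l" by (auto simp: T_def S'_def)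
  note D = skew_seidel_matD[OF S car]
  have "skew_seidel_mat T"
    unfolding skew_seidel_mat_iff[OF T]
  proof (intro conjI allI impI)
    fix i j assume "i < k" "j < k"
    then show "T $$ (j, i) = - T $$ (i, j)" using D(1)[of i j] by (simp add: T_def)
    show "i \<noteq> j \<Longrightarrow> \<bar>T $$ (i, j)\<bar> = 1" using \<open>i < k\<close> \<open>j < k\<close> D(3)[of i j] by (simp add: T_def)
  qed
  then have cT: "char_poly T = p" using assms(4) T by blast
  have "skew_seidel_mat S'"
    unfolding skew_seidel_mat_iff[OF S']
  proof (intro conjI allI impI)
    fix i j assume "i < l" "j < l"
    then show "S' $$ (j, i) = - S' $$ (i, j)" using D(1)[of "i + k" "j + k"] by (simp add: S'_def)
    show "i \<noteq> j \<Longrightarrow> \<bar>S' $$ (i, j)\<bar> = 1"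
      using \<open>i < l\<close> \<open>j < l\<close> D(3)[of "i + k" "j + k"] by (simp add: S'_def)
  qed
  moreover have "char_poly S' = p * [:c, 0, 1:] ^ (m - k)"
  proof -
    have "[:c, 0, 1:] ^ k * char_poly S' = [:c, 0, 1:] ^ (k + (m - k)) * p"
      using char_poly_principal_submatrix[OF car tr sq] k cp cT unfolding T_def[symmetric] S'_def[symmetric] by simp
    also have "\<dots> = [:c, 0, 1:] ^ k * (p * [:c, 0, 1:] ^ (m - k))" by (simp add: power_add mult_ac)
    finally show ?thesis by simp
  qed
  ultimately show ?thesis by blast
qed

section \<open>Restoring one, two or three rows and columns\<close>

lemma skew_seidel_extend:
  assumes S: "S \<in> carrier_mat n n" "skew_seidel_mat S" and k: "k \<in> {1, 2, 3}" and c: "c = int n + int k - 1"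
    and m: "k + n = 2 * m"
    and fac: "sign_factorisable (\<lambda>i j. (S * S + c \<cdot>\<^sub>m 1\<^sub>m n) $$ (i, j)) n k"
  shows "\<exists>S'. skew_seidel_mat S' \<and> char_poly S' = [:c, 0, 1:] ^ m"
proof -
  obtain S' where "S' \<in> carrier_mat (2 * m) (2 * m)" "skew_seidel_mat S'" "S' * S' = - c \<cdot>\<^sub>m 1\<^sub>m (2 * m)"
    using sign_factorisable_imp_completion[OF S k c fac] m by auto
  then show ?thesis using char_poly_eq_power by (metis skew_seidel_mat_def)
qed

text \<open>The order \<open>n\<close> equals \<open>c\<close>, so \<open>B\<close> has eigenvalues
  \<open>n\<close> and 0, diagonal 1 and odd entries.\<close>

lemma skew_seidel_extend_1:
  assumes S: "skew_seidel_mat S" and cp: "char_poly S = [:0, 1:] * [:int (4 * t + 3), 0, 1:] ^ (2 * t + 1)"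
  shows "\<exists>S'. skew_seidel_mat S' \<and> char_poly S' = [:int (4 * t + 3), 0, 1:] ^ (2 * t + 2)"
proof -
  define n where "n = 4 * t + 3"
  define B where "B = S * S + int n \<cdot>\<^sub>m 1\<^sub>m n"
  have "degree (char_poly S) = n"
    unfolding cp by (subst degree_times_quadratic_power) (simp_all add: n_def)
  then obtain P Q e where car: "S \<in> carrier_mat n n" and tr: "triangularising P Q n"
    and e: "triangularised P Q n S e"
    and roots: "\<And>i. i < n \<Longrightarrow> poly (map_poly of_int (char_poly S)) (e i) = 0"
    using skew_seidel_eigenvalues[OF S] by metis
  interpret triangularising P Q n by fact
  have e0: "e i = 0 \<or> e i * e i + of_int n = 0" if "i < n" for i
    using roots[OF that] unfolding cp of_int_poly_hom.hom_mult of_int_poly_hom.hom_power poly_mult poly_power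
      poly_of_int_X poly_of_int_quadratic mult_eq_0_iff power_eq_0_iff
    by (auto simp: n_def algebra_simps)
  have tB: "triangularised P Q n B (\<lambda>i. e i * e i + of_int n)"
    using triangularised_sqr_shift[OF e, of "int n"] by (simp add: B_def)
  have "scaled_projection (\<lambda>i j. B $$ (i, j)) n (int n)"
  proof (rule triangularised_scaled_projection[OF tB])
    show "(e i * e i + of_int n) * (e i * e i + of_int n) = of_int (int n) * (e i * e i + of_int n)" if "i < n" for i
      using e0[OF that] by auto
  qed (use skew_seidel_sqr_shift_sym[OF car S] in \<open>auto simp: B_def n_def\<close>)
  moreover have "B $$ (i, i) = 1" if "i < n" for i
    using skew_seidel_sqr_shift_diag[OF car S that] by (simp add: B_def)
  moreover have "odd (B $$ (i, j))" if "i < n" "j < n" for i j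
  proof (cases "i = j")
    case True
    then show ?thesis using calculation(2) that by simp
  next
    case False
    then show ?thesis using skew_seidel_sqr_shift_parity[OF car S that] by (simp add: B_def n_def)
  qed
  ultimately have "sign_factorisable (\<lambda>i j. B $$ (i, j)) n 1" by (intro sign_factorisable_1) auto
  then show ?thesis
    using skew_seidel_extend[OF car S, of 1 "int n" "2 * t + 2"] by (simp add: B_def n_def)
qed

text \<open>Here \<open>c = n + 1\<close>: the squares -1 and \<open>- c\<close> of eigenvalues
  shift to \<open>n\<close> and 0, the diagonal is 2 and all entries are even.\<close>

lemma skew_seidel_extend_2:
  assumes S: "skew_seidel_mat S" and cp: "char_poly S = [:1, 0, 1:] * [:int (4 * t + 3), 0, 1:] ^ (2 * t)"
  shows "\<exists>S'. skew_seidel_mat S' \<and> char_poly S' = [:int (4 * t + 3), 0, 1:] ^ (2 * t + 2)"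
proof -
  define n where "n = 4 * t + 2"
  define B where "B = S * S + (int n + 1) \<cdot>\<^sub>m 1\<^sub>m n"
  have "degree (char_poly S) = n"
    unfolding cp by (subst degree_times_quadratic_power) (simp_all add: n_def)
  then obtain P Q e where car: "S \<in> carrier_mat n n" and tr: "triangularising P Q n"
    and e: "triangularised P Q n S e"
    and roots: "\<And>i. i < n \<Longrightarrow> poly (map_poly of_int (char_poly S)) (e i) = 0"
    using skew_seidel_eigenvalues[OF S] by metis
  interpret triangularising P Q n by fact
  have e0: "e i * e i + 1 = 0 \<or> e i * e i + (of_int n + 1) = 0" if "i < n" for i
    using roots[OF that] unfolding cp of_int_poly_hom.hom_mult of_int_poly_hom.hom_power poly_mult poly_power
      poly_of_int_X poly_of_int_quadratic mult_eq_0_iff power_eq_0_iff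
    by (auto simp: n_def algebra_simps)
  have tB: "triangularised P Q n B (\<lambda>i. e i * e i + (of_int n + 1))"
    using triangularised_sqr_shift[OF e, of "int n + 1"] by (simp add: B_def)
  have "scaled_projection (\<lambda>i j. B $$ (i, j)) n (int n)"
  proof (rule triangularised_scaled_projection[OF tB])
    show "(e i * e i + (of_int n + 1)) * (e i * e i + (of_int n + 1)) = of_int (int n) * (e i * e i + (of_int n + 1))"
      if "i < n" for i
    proof -
      have "e i * e i + (of_int n + 1) = 0 \<or> e i * e i + (of_int n + 1) = of_int n"
        using e0[OF that] by (auto simp: algebra_simps)
      then show ?thesis by auto
    qed
  qed (use skew_seidel_sqr_shift_sym[OF car S] in \<open>auto simp: B_def n_def\<close>)
  moreover have "B $$ (i, i) = 2" if "i < n" for i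
    using skew_seidel_sqr_shift_diag[OF car S that] by (simp add: B_def)
  moreover have "even (B $$ (i, j))" if "i < n" "j < n" for i j
  proof (cases "i = j")
    case True
    then show ?thesis using calculation(2) that by simp
  next
    case False
    then show ?thesis using skew_seidel_sqr_shift_parity[OF car S that] by (simp add: B_def n_def)
  qed
  ultimately have "sign_factorisable (\<lambda>i j. B $$ (i, j)) n 2"
    by (intro sign_factorisable_2[where m = "2 * t + 1"]) (auto simp: n_def)
  then show ?thesis
    using skew_seidel_extend[OF car S, of 2 "int n + 1" "2 * t + 2"] by (simp add: B_def n_def add_ac)
qed

lemma skew_seidel_extend_3:
  assumes t: "t > 0" and S: "skew_seidel_mat S"
    and cp: "char_poly S = [:0, 1:] * [:3, 0, 1:] * [:int (4 * t + 3), 0, 1:] ^ (2 * t - 1)"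
  shows "\<exists>S'. skew_seidel_mat S' \<and> char_poly S' = [:int (4 * t + 3), 0, 1:] ^ (2 * t + 2)"
proof -
  define n where "n = 4 * t + 1"
  define c where "c = 4 * int t + 3"
  define B where "B = S * S + c \<cdot>\<^sub>m 1\<^sub>m n"
  have "degree (char_poly S) = n"
    unfolding cp using t by (subst degree_times_quadratic_power) (simp_all add: n_def)
  then obtain P Q e where car: "S \<in> carrier_mat n n" and tr: "triangularising P Q n"
    and e: "triangularised P Q n S e"
    and roots: "\<And>i. i < n \<Longrightarrow> poly (map_poly of_int (char_poly S)) (e i) = 0"
    using skew_seidel_eigenvalues[OF S] by metis
  interpret triangularising P Q n by fact
  define f where "f = (\<lambda>i. e i * e i + of_int c)"
  have e0: "e i = 0 \<or> e i * e i + 3 = 0 \<or> e i * e i + of_int c = 0" if "i < n" for i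
    using roots[OF that] unfolding cp of_int_poly_hom.hom_mult of_int_poly_hom.hom_power poly_mult poly_power
      poly_of_int_X poly_of_int_quadratic mult_eq_0_iff power_eq_0_iff
    by (auto simp: c_def algebra_simps)
  have f: "f i = of_int c \<or> f i = of_int (4 * int t) \<or> f i = 0" if i: "i < n" for i
  proof -
    consider "e i = 0" | "e i * e i + 3 = 0" | "f i = 0" using e0[OF i] by (auto simp: f_def)
    then show ?thesis
    proof cases
      case 2
      then have "f i = of_int c - 3" by (simp add: f_def algebra_simps eq_neg_iff_add_eq_0)
      then show ?thesis by (simp add: c_def)
    qed (auto simp: f_def)
  qed
  have tB: "triangularised P Q n B f"
    using triangularised_sqr_shift[OF e, of c] by (simp add: B_def f_def)
  have cB: "B \<in> carrier_mat n n" using car by (simp add: B_def)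
  have sym: "B $$ (i, j) = B $$ (j, i)" if "i < n" "j < n" for i j
    using skew_seidel_sqr_shift_sym[OF car S that] by (simp add: B_def)
  have diag: "B $$ (i, i) = 3" if "i < n" for i
    using skew_seidel_sqr_shift_diag[OF car S that] by (simp add: B_def c_def n_def)
  have odd: "odd (B $$ (i, j))" if "i < n" "j < n" for i j
  proof (cases "i = j")
    case True
    then show ?thesis using diag that by simp
  next
    case False
    then show ?thesis using skew_seidel_sqr_shift_parity[OF car S that] by (simp add: B_def n_def)
  qed
  define bb where "bb = (\<lambda>i j. \<Sum>k<n. B $$ (i, k) * B $$ (k, j))"
  have idx: "(B * B) $$ (i, j) = bb i j" if "i < n" "j < n" for i j
    using cB that by (simp add: bb_def scalar_prod_def lessThan_atLeast0)
  have bb_sym: "bb i j = bb j i" if "i < n" "j < n" for i j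
    unfolding bb_def using sym that by (intro sum.cong refl) (simp add: mult.commute)
  \<comment> \<open>\<open>G\<close> kills the eigenvalue \<open>c\<close> and takes the value
    \<open>4t (c - 4t) = 12t\<close> at \<open>4t\<close>; \<open>E\<close> kills \<open>4t\<close>
    and takes the value \<open>c (c - 4t) = 3c\<close> at \<open>c\<close>. Both vanish at
    0.\<close>
  define G where "G = c \<cdot>\<^sub>m B + (-1) \<cdot>\<^sub>m (B * B)"
  define E where "E = B * B + (- (4 * int t)) \<cdot>\<^sub>m B"
  have G_idx: "G $$ (i, j) = c * B $$ (i, j) - bb i j" if "i < n" "j < n" for i j
    using cB that idx[OF that] by (simp add: G_def del: index_mult_mat(1))
  have E_idx: "E $$ (i, j) = bb i j - 4 * int t * B $$ (i, j)" if "i < n" "j < n" for i j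
    using cB that idx[OF that] by (simp add: E_def del: index_mult_mat(1))
  have tG: "triangularised P Q n G (\<lambda>i. of_int c * f i + of_int (-1) * (f i * f i))"
    unfolding G_def by (intro triangularised_add triangularised_mult triangularised_smult tB)
  have tE: "triangularised P Q n E (\<lambda>i. f i * f i + of_int (- (4 * int t)) * f i)"
    unfolding E_def by (intro triangularised_add triangularised_mult triangularised_smult tB)
  have pG: "scaled_projection (\<lambda>i j. G $$ (i, j)) n (12 * int t)"
  proof (rule triangularised_scaled_projection[OF tG])
    show "G $$ (i, j) = G $$ (j, i)" if "i < n" "j < n" for i j
      using that by (simp add: G_idx sym[OF that] bb_sym[OF that])
    show "(of_int c * f i + of_int (-1) * (f i * f i)) * (of_int c * f i + of_int (-1) * (f i * f i))
        = of_int (12 * int t) * (of_int c * f i + of_int (-1) * (f i * f i))" if "i < n" for i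
      using f[OF that] by (elim disjE) (simp_all add: c_def algebra_simps)
  qed (use t in simp)
  have pE: "scaled_projection (\<lambda>i j. E $$ (i, j)) n (3 * c)"
  proof (rule triangularised_scaled_projection[OF tE])
    show "E $$ (i, j) = E $$ (j, i)" if "i < n" "j < n" for i j
      using that by (simp add: E_idx sym[OF that] bb_sym[OF that])
    show "(f i * f i + of_int (- (4 * int t)) * f i) * (f i * f i + of_int (- (4 * int t)) * f i)
        = of_int (3 * c) * (f i * f i + of_int (- (4 * int t)) * f i)" if "i < n" for i
      using f[OF that] by (elim disjE) (simp_all add: c_def algebra_simps)
  qed (simp add: c_def)
  define \<alpha> where "\<alpha> = card {i. i < n \<and> f i = of_int c}"
  define \<beta> where "\<beta> = card {i. i < n \<and> f i = of_int (4 * int t)}"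
  have c_ne: "(of_int c :: complex) \<noteq> of_int (4 * int t)" "(of_int c :: complex) \<noteq> 0"
    "(of_int (4 * int t) :: complex) \<noteq> 0"
    using t unfolding of_int_eq_iff of_int_eq_0_iff by (auto simp: c_def)
  have count: "(\<Sum>i<n. if f i = x then y else 0) = of_nat (card {i. i < n \<and> f i = x}) * y" for x y :: complex
    by (simp add: sum.If_cases Int_def lessThan_def)
  have "of_int (\<Sum>i<n. B $$ (i, i)) = (\<Sum>i<n. f i)" by (rule triangularised_trace[OF tB])
  also have "\<dots> = (\<Sum>i<n. (if f i = of_int c then of_int c else 0) + (if f i = of_int (4 * int t) then of_int (4 * int t) else 0))"
  proof (intro sum.cong refl)
    fix i assume "i \<in> {..<n}"
    then have "f i = of_int c \<or> f i = of_int (4 * int t) \<or> f i = 0" using f by blast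
    then show "f i = (if f i = of_int c then of_int c else 0) + (if f i = of_int (4 * int t) then of_int (4 * int t) else 0)"
      using c_ne by (elim disjE) simp_all
  qed
  also have "\<dots> = of_int (int \<alpha> * c + int \<beta> * (4 * int t))"
    by (simp only: sum.distrib count \<alpha>_def \<beta>_def of_int_add of_int_mult of_int_of_nat_eq)
  finally have "(\<Sum>i<n. B $$ (i, i)) = int \<alpha> * c + int \<beta> * (4 * int t)" by (simp only: of_int_eq_iff)
  then have eq: "int \<alpha> * c + 4 * (int \<beta> * int t) = 12 * int t + 3" using diag by (simp add: n_def)
  \<comment> \<open>The multiplicity of \<open>c\<close> comes from the trace:
    \<open>\<alpha> \<ge> 3\<close> would exceed \<open>12t + 3\<close>, and modulo 4 the equation
    reads \<open>3 \<alpha> = 3\<close>.\<close>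
  have "\<alpha> = 1"
  proof -
    have "\<alpha> < 3"
    proof (rule ccontr)
      assume "\<not> \<alpha> < 3"
      then have "3 * c \<le> int \<alpha> * c" by (intro mult_right_mono) (auto simp: c_def)
      moreover have "0 \<le> int \<beta> * int t" by simp
      ultimately show False using eq c_def by linarith
    qed
    then have "\<alpha> = 0 \<or> \<alpha> = 1 \<or> \<alpha> = 2" by auto
    moreover obtain x where "int \<beta> * int t = x" by blast
    ultimately show ?thesis
      using eq unfolding c_def by (elim disjE) (simp_all, presburger+)
  qed
  have "of_int (\<Sum>i<n. E $$ (i, i)) = (\<Sum>i<n. f i * f i + of_int (- (4 * int t)) * f i)"
    by (rule triangularised_trace[OF tE])
  also have "\<dots> = (\<Sum>i<n. if f i = of_int c then of_int (3 * c) else 0)"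
  proof (intro sum.cong refl)
    fix i assume "i \<in> {..<n}"
    then have "f i = of_int c \<or> f i = of_int (4 * int t) \<or> f i = 0" using f by blast
    moreover have "of_int c * of_int c + of_int (- (4 * int t)) * of_int c = (of_int (3 * c) :: complex)"
      by (simp add: c_def algebra_simps)
    ultimately show "f i * f i + of_int (- (4 * int t)) * f i = (if f i = of_int c then of_int (3 * c) else 0)"
      using c_ne by (elim disjE) simp_all
  qed
  also have "\<dots> = of_int (3 * c)" using \<open>\<alpha> = 1\<close> by (simp add: count flip: \<alpha>_def)
  finally have trace: "(\<Sum>i<n. E $$ (i, i)) = 3 * c" by (simp only: of_int_eq_iff)
  have pG': "scaled_projection (\<lambda>i j. c * B $$ (i, j) - bb i j) n (12 * int t)"
    by (rule scaled_projection_cong[OF pG G_idx])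
  have pE': "scaled_projection (\<lambda>i j. bb i j - 4 * int t * B $$ (i, j)) n (3 * c)"
    by (rule scaled_projection_cong[OF pE E_idx])
  have "sign_factorisable (\<lambda>i j. B $$ (i, j)) n 3"
    unfolding n_def
  proof (rule sign_factorisable_3)
    show "(\<Sum>i<4 * t + 1. (\<Sum>k<4 * t + 1. B $$ (i, k) * B $$ (k, i)) - 4 * int t * B $$ (i, i)) = 3 * (4 * int t + 3)"
      using trace E_idx unfolding n_def c_def bb_def by simp
  qed (use pG' pE' sym diag odd in \<open>auto simp: n_def c_def bb_def\<close>)
  then show ?thesis
    using skew_seidel_extend[OF car S, of 3 c "2 * t + 2"] t by (simp add: B_def n_def c_def add_ac)
qed

theorem theorem4p1:
  fixes t :: nat
  assumes "t > 0"
  shows "((\<exists>S. skew_seidel_mat S \<and>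
             char_poly S = ([:0, 1:]\<^sup>2 + of_nat (4 * t + 3)) ^ (2 * t + 2))
          \<longleftrightarrow>
          (\<exists>S. skew_seidel_mat S \<and>
             char_poly S = [:0, 1:] * ([:0, 1:]\<^sup>2 + of_nat (4 * t + 3)) ^ (2 * t + 1)))
       \<and> ((\<exists>S. skew_seidel_mat S \<and>
             char_poly S = [:0, 1:] * ([:0, 1:]\<^sup>2 + of_nat (4 * t + 3)) ^ (2 * t + 1))
          \<longleftrightarrow>
          (\<exists>S. skew_seidel_mat S \<and>
             char_poly S = ([:0, 1:]\<^sup>2 + 1) * ([:0, 1:]\<^sup>2 + of_nat (4 * t + 3)) ^ (2 * t)))
       \<and> ((\<exists>S. skew_seidel_mat S \<and>
             char_poly S = ([:0, 1:]\<^sup>2 + 1) * ([:0, 1:]\<^sup>2 + of_nat (4 * t + 3)) ^ (2 * t))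
          \<longleftrightarrow>
          (\<exists>S. skew_seidel_mat S \<and>
             char_poly S = [:0, 1:] * ([:0, 1:]\<^sup>2 + 3) * ([:0, 1:]\<^sup>2 + of_nat (4 * t + 3)) ^ (2 * t - 1)))"
proof -
  have q: "[:0, 1:]\<^sup>2 + of_nat m = [:int m, 0, 1:]" for m
    by (simp add: power2_eq_square of_nat_poly)
  have q1: "[:0, 1:]\<^sup>2 + 1 = [:1, 0, 1 :: int:]" and q3: "[:0, 1:]\<^sup>2 + 3 = [:3, 0, 1 :: int:]"
    using q[of 1] q[of 3] by simp_all
  let ?q = "[:int (4 * t + 3), 0, 1:]"
  define E0 where "E0 = (\<exists>S. skew_seidel_mat S \<and> char_poly S = ?q ^ (2 * t + 2))"
  define E1 where "E1 = (\<exists>S. skew_seidel_mat S \<and> char_poly S = [:0, 1:] * ?q ^ (2 * t + 1))"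
  define E2 where "E2 = (\<exists>S. skew_seidel_mat S \<and> char_poly S = [:1, 0, 1:] * ?q ^ (2 * t))"
  define E3 where "E3 = (\<exists>S. skew_seidel_mat S \<and> char_poly S = [:0, 1:] * [:3, 0, 1:] * ?q ^ (2 * t - 1))"
  have "E0 \<longleftrightarrow> E1"
  proof
    assume E0
    then obtain S where S: "skew_seidel_mat S" "char_poly S = ?q ^ (2 * t + 2)" unfolding E0_def by blast
    then show E1
      unfolding E1_def using skew_seidel_delete[OF S, of 1, OF _ char_poly_skew_seidel_1] by simp
  qed (use skew_seidel_extend_1 in \<open>auto simp only: E0_def E1_def\<close>)
  moreover have "E0 \<longleftrightarrow> E2"
  proof
    assume E0
    then obtain S where S: "skew_seidel_mat S" "char_poly S = ?q ^ (2 * t + 2)" unfolding E0_def by blast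
    then show E2
      unfolding E2_def using skew_seidel_delete[OF S, of 2, OF _ char_poly_skew_seidel_2] by simp
  qed (use skew_seidel_extend_2 in \<open>auto simp only: E0_def E2_def\<close>)
  moreover have "E0 \<longleftrightarrow> E3"
  proof
    assume E0
    then obtain S where S: "skew_seidel_mat S" "char_poly S = ?q ^ (2 * t + 2)" unfolding E0_def by blast
    \<comment> \<open>Positivity of \<open>t\<close> enters here: three rows can be deleted only if
      \<open>3 \<le> 2t + 2\<close>.\<close>
    have "2 * t + 2 - 3 = 2 * t - 1" "3 \<le> 2 * t + 2" using assms by auto
    then show E3
      unfolding E3_def using skew_seidel_delete[OF S, of 3, OF _ char_poly_skew_seidel_3] by metis
  qed (use skew_seidel_extend_3[OF assms] in \<open>auto simp only: E0_def E3_def\<close>)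
  ultimately show ?thesis
    unfolding q q1 q3 E0_def[symmetric] E1_def[symmetric] E2_def[symmetric] E3_def[symmetric] by blast
qed

end
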